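(* Let $\theta\in(0,\pi/2)$ and let $K_\theta$ be the rhombic Vicsek fractal with angle $2\theta$, endowed with the discrete spectral triple. Then, for finite energy functions $f$, the residue at $\delta=1$ of the zeta function $Z_{|[D,f]|^2}(s)=\operatorname{Tr}(|[D,f]|^2\,|D|^{-s})$ exists and coincides, up to a multiplicative constant (independent of $f$), with the self-similar energy associated with the eigenform with conductances $(1,1,1,1,H,H^{-1})$ on the Vicsek square, where $$H=\frac{2+\sqrt{1+\tan^2\theta}}{2+\sqrt{1+\cot^2\theta}}.$$ Moreover, any $H>0$ can be uniquely obtained in this way from a $\theta\in(0,\pi/2)$.
   Context: Rhombic Vicsek fractal. For $\theta\in(0,\pi/2)$ consider the rhombus in $\mathbb R^2$ with side length $1$, angle $2\theta$ and diagonals of length $2\cos\theta$ and $2\sin\theta$; e.g. with vertices $(\pm\cos\theta,0)$, $(0,\pm\sin\theta)$ and center $0$. Let $w_1,\dots,w_5$ be the similitudes $w_i(x)=p_i+\frac13(x-p_i)$, where $p_1,\dots,p_4$ are the vertices and $p_5$ is the center of the rhombus. $K_\theta$ is the unique non-empty compact set with $K_\theta=\bigcup_{i=1}^5w_i(K_\theta)$; here $\lambda=1/3$. $V_0$ is the set of the four vertices, $E_0=\{(p,q):p,q\in V_0,\ p\ne q\}$, and for $e=(p,q)$ write $e^+=p$, $e^-=q$, $\ell(e)=\|p-q\|$. The case $\theta=\pi/4$ is the Vicsek square (Vicsek snowflake). The linear map of $\mathbb R^2$ sending the vertices of the square ($\theta=\pi/4$) to the corresponding vertices of the rhombus maps $K_{\pi/4}$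 homeomorphically onto $K_\theta$ intertwining the maps $w_i$; functions on $K_\theta$ are identified with functions on $K_{\pi/4}$ in this way. $\Sigma_n$ is the set of maps $\sigma:\{1,\dots,n\}\to\{1,\dots,5\}$, $|\sigma|=n$, $w_\sigma=w_{\sigma(1)}\circ\cdots\circ w_{\sigma(n)}$, $\Sigma_0=\{\emptyset\}$, $w_\emptyset=\mathrm{id}$, $\Sigma=\bigcup_{n\ge0}\Sigma_n$; $V_n=\bigcup_{\sigma\in\Sigma_n}w_\sigma(V_0)$. Discrete spectral triple on $K_\theta$. $\mathcal H$ has orthonormal basis $\{\delta_{\sigma,e}:\sigma\in\Sigma,\ e\in E_0\}$; $f\in C(K_\theta)$ acts by $f\,\delta_{\sigma,e}=f(w_\sigma(e^+))\,\delta_{\sigma,e}$; $D\,\delta_{\sigma,e}=3^{|\sigma|}\ell(e)^{-1}\delta_{\sigma,\bar e}$ with $\bar e=(e^-,e^+)$. The operators $|[D,f]|$ and $|D|$ are both diagonal in this basis; $|[D,f]|^2|D|^{-s}$ denotes the corresponding positive diagonal operator, with trace in $[0,\infty]$. The residue is $\operatorname{Res}_{s=1}Z(s)=\lim_{s\to1^+}(s-1)Z(s)$. Energies on the Vicsek square. A quadratic functional on $C(V_0)$ (real functions on $V_0$) is $\mathcal E[g]=\sum_{(p,q)\in E_0}c_{pq}(g(p)-g(q))^2$ with conductances $c_{pq}=c_{qp}>0$; conductances $(1,1,1,1,H,H^{-1})$ means: $1$ on the four sides, $H$ on one diagonal and $H^{-1}$ on the other; under the identification, the diagonal with conductance $H$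 corresponds to the diagonal of length $2\cos\theta$ of the rhombus. Put $S_n(\mathcal E)[f]=\sum_{\sigma\in\Sigma_n}\mathcal E[f\circ w_\sigma]$. $\mathcal E$ is an eigenform with eigenvalue $\rho$ if $\inf\{S_1(\mathcal E)[g]:g\in C(V_1),\,g|_{V_0}=f\}=\rho\,\mathcal E[f]$ for all $f\in C(V_0)$. It is known (Metz) that, up to a scalar multiple, the eigenforms for the Vicsek square are exactly those with conductances $(1,1,1,1,H,H^{-1})$, $H>0$, with $\rho=1/3$. The self-similar energy associated with an eigenform $\mathcal E$ is $\mathcal E_\infty[f]=\lim_n\rho^{-n}S_n(\mathcal E)[f]$. A real-valued continuous $f$ has finite energy if $\mathcal E_\infty[f]<\infty$ for some (equivalently, every) eigenform $\mathcal E$. *)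

theory Defs
  imports "HOL-Analysis.Analysis"
begin

section \<open>The rhombic Vicsek fractal\<close>

definition pt :: "real \<Rightarrow> nat \<Rightarrow> real ^ 2" where
  "pt \<theta> i =
    (if i = 1 then vector [cos \<theta>, 0]
     else if i = 2 then vector [0, sin \<theta>]
     else if i = 3 then vector [- cos \<theta>, 0]
     else if i = 4 then vector [0, - sin \<theta>]
     else 0)"

definition sim :: "real \<Rightarrow> nat \<Rightarrow> real ^ 2 \<Rightarrow> real ^ 2" where
  "sim \<theta> i x = pt \<theta> i + (1/3) *\<^sub>R (x - pt \<theta> i)"

definition fractal :: "real \<Rightarrow> (real ^ 2) set" where
  "fractal \<theta> = (THE K. compact K \<and> K \<noteq> {} \<and> K = (\<Union>i\<in>{1..5}. sim \<theta> i ` K))"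

definition V0 :: "real \<Rightarrow> (real ^ 2) set" where
  "V0 \<theta> = pt \<theta> ` {1..4}"

definition E0 :: "real \<Rightarrow> ((real ^ 2) \<times> (real ^ 2)) set" where
  "E0 \<theta> = {(p, q). p \<in> V0 \<theta> \<and> q \<in> V0 \<theta> \<and> p \<noteq> q}"

definition edge_length :: "(real ^ 2) \<times> (real ^ 2) \<Rightarrow> real" where
  "edge_length e = norm (fst e - snd e)"

definition words :: "nat \<Rightarrow> nat list set" where
  "words n = {\<sigma>. set \<sigma> \<subseteq> {1..5} \<and> length \<sigma> = n}"

text \<open>For \<open>\<sigma> = [i\<^sub>1, \<dots>, i\<^sub>n]\<close> this is \<open>w\<close>(\<open>i\<^sub>1\<close>) \<open>\<circ> \<dots> \<circ>\<close> \<open>w\<close>(\<open>i\<^sub>n\<close>).\<close>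

definition sim_word :: "real \<Rightarrow> nat list \<Rightarrow> real ^ 2 \<Rightarrow> real ^ 2" where
  "sim_word \<theta> \<sigma> = foldr (\<lambda>i g. sim \<theta> i \<circ> g) \<sigma> id"

text \<open>The linear map carrying the vertices of the square (angle \<open>pi/4\<close>) to the
  corresponding vertices of the rhombus. A function \<open>f\<close> on \<open>fractal \<theta>\<close> is identified
  with \<open>f \<circ> to_rhombus \<theta>\<close> on the square fractal.\<close>

definition to_rhombus :: "real \<Rightarrow> real ^ 2 \<Rightarrow> real ^ 2" where
  "to_rhombus \<theta> x = vector [cos \<theta> / cos (pi/4) * x $ 1, sin \<theta> / sin (pi/4) * x $ 2]"


section \<open>The discrete spectral triple\<close>

text \<open>Vectors are given by their coordinates in the orthonormal basis, which is indexed by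
  the words and the edges; operators act on coordinates. The unbounded operators below are
  only ever applied to basis vectors.\<close>

type_synonym idx = "nat list \<times> ((real ^ 2) \<times> (real ^ 2))"
type_synonym hvec = "idx \<Rightarrow> complex"

definition index_set :: "real \<Rightarrow> idx set" where
  "index_set \<theta> = (\<Union>n. words n) \<times> E0 \<theta>"

definition hilbert :: "real \<Rightarrow> hvec set" where
  "hilbert \<theta> = {\<xi>. (\<forall>k. k \<notin> index_set \<theta> \<longrightarrow> \<xi> k = 0) \<and> (\<lambda>k. (cmod (\<xi> k))\<^sup>2) summable_on UNIV}"

definition ip :: "hvec \<Rightarrow> hvec \<Rightarrow> complex" where
  "ip \<xi> \<eta> = (\<Sum>\<^sub>\<infinity>k. cnj (\<xi> k) * \<eta> k)"

definition basis_vec :: "idx \<Rightarrow> hvec" where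
  "basis_vec k = (\<lambda>j. if j = k then 1 else 0)"

definition rep :: "real \<Rightarrow> (real ^ 2 \<Rightarrow> complex) \<Rightarrow> hvec \<Rightarrow> hvec" where
  "rep \<theta> f \<xi> = (\<lambda>(\<sigma>, e). f (sim_word \<theta> \<sigma> (fst e)) * \<xi> (\<sigma>, e))"

definition dirac :: "hvec \<Rightarrow> hvec" where
  "dirac \<xi> = (\<lambda>(\<sigma>, e). of_real (3 ^ length \<sigma> / edge_length e) * \<xi> (\<sigma>, prod.swap e))"

definition dirac_commutator :: "real \<Rightarrow> (real ^ 2 \<Rightarrow> complex) \<Rightarrow> hvec \<Rightarrow> hvec" where
  "dirac_commutator \<theta> f \<xi> = (\<lambda>k. dirac (rep \<theta> f \<xi>) k - rep \<theta> f (dirac \<xi>) k)"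

definition diag_op :: "(idx \<Rightarrow> real) \<Rightarrow> hvec \<Rightarrow> hvec" where
  "diag_op a \<xi> = (\<lambda>k. of_real (a k) * \<xi> k)"

text \<open>If \<open>|T|\<close> is diagonal in the basis, its eigenvalue at \<open>\<delta>\<^sub>k\<close> is the norm of \<open>T \<delta>\<^sub>k\<close>.
  For the operators used here diagonality is part of \<open>abs_op_dirac\<close> and
  \<open>abs_op_commutator\<close> below, which say that \<open>|T|\<^sup>2 = T\<^sup>* T\<close> on basis vectors.\<close>

definition abs_eigenvalue :: "(hvec \<Rightarrow> hvec) \<Rightarrow> idx \<Rightarrow> real" where
  "abs_eigenvalue T k = sqrt (Re (ip (T (basis_vec k)) (T (basis_vec k))))"

definition abs_op :: "(hvec \<Rightarrow> hvec) \<Rightarrow> hvec \<Rightarrow> hvec" where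
  "abs_op T = diag_op (abs_eigenvalue T)"

definition abs_op_power :: "(hvec \<Rightarrow> hvec) \<Rightarrow> real \<Rightarrow> hvec \<Rightarrow> hvec" where
  "abs_op_power T s = diag_op (\<lambda>k. abs_eigenvalue T k powr s)"

definition op_trace :: "real \<Rightarrow> (hvec \<Rightarrow> hvec) \<Rightarrow> ennreal" where
  "op_trace \<theta> A = (\<Sum>\<^sub>\<infinity>k\<in>index_set \<theta>. ennreal (Re (ip (basis_vec k) (A (basis_vec k)))))"

definition zeta_comm :: "real \<Rightarrow> (real ^ 2 \<Rightarrow> complex) \<Rightarrow> real \<Rightarrow> ennreal" where
  "zeta_comm \<theta> f s =
    op_trace \<theta> (abs_op (dirac_commutator \<theta> f) \<circ> abs_op (dirac_commutator \<theta> f) \<circ> abs_op_power dirac (- s))"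

definition has_residue_at_1 :: "(real \<Rightarrow> ennreal) \<Rightarrow> real \<Rightarrow> bool" where
  "has_residue_at_1 Z r \<longleftrightarrow>
    r \<ge> 0 \<and> ((\<lambda>s. ennreal (s - 1) * Z s) \<longlongrightarrow> ennreal r) (at_right 1)"

lemma ip_scaled_basis:
  "ip (\<lambda>j. a * basis_vec k j) (\<lambda>j. b * basis_vec l j) = (if k = l then cnj a * b else 0)"
proof -
  have "ip (\<lambda>j. a * basis_vec k j) (\<lambda>j. b * basis_vec l j)
      = (\<Sum>\<^sub>\<infinity>j\<in>{k}. cnj (a * basis_vec k j) * (b * basis_vec l j))"
    unfolding ip_def by (rule infsum_cong_neutral) (auto simp: basis_vec_def)
  then show ?thesis by (simp add: basis_vec_def)
qed

lemma ip_basis: "ip (basis_vec k) (basis_vec l) = (if k = l then 1 else 0)"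
  using ip_scaled_basis[of 1 k 1 l] by simp

lemma basis_vec_hilbert:
  assumes "k \<in> index_set \<theta>"
  shows "basis_vec k \<in> hilbert \<theta>"
proof -
  have "(\<lambda>j. (cmod (basis_vec k j))\<^sup>2) summable_on {k}"
    by (rule summable_on_finite) simp
  then have "(\<lambda>j. (cmod (basis_vec k j))\<^sup>2) summable_on UNIV"
    by (rule summable_on_cong_neutral[THEN iffD1, rotated -1]) (auto simp: basis_vec_def)
  with assms show ?thesis by (auto simp: hilbert_def basis_vec_def)
qed

lemma rep_basis:
  "rep \<theta> f (basis_vec (\<sigma>, e)) = (\<lambda>j. f (sim_word \<theta> \<sigma> (fst e)) * basis_vec (\<sigma>, e) j)"
  by (rule ext) (auto simp: rep_def basis_vec_def split: if_splits)

lemma dirac_basis: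
  "dirac (basis_vec (\<sigma>, e))
    = (\<lambda>j. of_real (3 ^ length \<sigma> / edge_length e) * basis_vec (\<sigma>, prod.swap e) j)"
  by (cases e, rule ext)
    (auto simp: dirac_def basis_vec_def edge_length_def norm_minus_commute split: if_splits)

lemma dirac_commutator_basis:
  "dirac_commutator \<theta> f (basis_vec (\<sigma>, e))
    = (\<lambda>j. of_real (3 ^ length \<sigma> / edge_length e)
          * (f (sim_word \<theta> \<sigma> (fst e)) - f (sim_word \<theta> \<sigma> (snd e)))
          * basis_vec (\<sigma>, prod.swap e) j)"
  by (cases e, rule ext)
    (auto simp: dirac_commutator_def dirac_def rep_def basis_vec_def edge_length_def
      norm_minus_commute right_diff_distrib diff_divide_distrib split: if_splits)

lemma abs_op_scaled_swap:
  assumes "\<And>\<sigma> e. T (basis_vec (\<sigma>, e)) = (\<lambda>j. c \<sigma> e * basis_vec (\<sigma>, prod.swap e) j)"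
  shows "ip (abs_op T (basis_vec k)) (abs_op T (basis_vec l)) = ip (T (basis_vec k)) (T (basis_vec l))"
proof -
  obtain \<sigma> e \<tau> d where kl: "k = (\<sigma>, e)" "l = (\<tau>, d)" by (metis surj_pair)
  have ev: "abs_eigenvalue T (\<sigma>, e) = cmod (c \<sigma> e)" for \<sigma> e
    unfolding abs_eigenvalue_def assms ip_scaled_basis
    by (simp add: cmod_def power2_eq_square)
  have ab: "abs_op T (basis_vec m) = (\<lambda>j. of_real (abs_eigenvalue T m) * basis_vec m j)" for m
    by (rule ext) (simp add: abs_op_def diag_op_def basis_vec_def)
  have "prod.swap e = prod.swap d \<longleftrightarrow> e = d"
    by (metis swap_swap)
  moreover have "cnj z * z = complex_of_real (cmod z) * complex_of_real (cmod z)" for z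
    by (metis complex_norm_square mult.commute power2_eq_square of_real_power)
  ultimately show ?thesis
    unfolding ab ip_scaled_basis kl assms ev by auto
qed

lemma abs_op_dirac:
  "ip (abs_op dirac (basis_vec k)) (abs_op dirac (basis_vec l))
    = ip (dirac (basis_vec k)) (dirac (basis_vec l))"
  by (rule abs_op_scaled_swap) (rule dirac_basis)

lemma abs_op_commutator:
  "ip (abs_op (dirac_commutator \<theta> f) (basis_vec k)) (abs_op (dirac_commutator \<theta> f) (basis_vec l))
    = ip (dirac_commutator \<theta> f (basis_vec k)) (dirac_commutator \<theta> f (basis_vec l))"
  by (rule abs_op_scaled_swap) (rule dirac_commutator_basis)


section \<open>Self-similar energies on the Vicsek square\<close>

abbreviation "square \<equiv> pi / 4"

definition is_conductance :: "(real ^ 2 \<Rightarrow> real ^ 2 \<Rightarrow> real) \<Rightarrow> bool" where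
  "is_conductance c \<longleftrightarrow> (\<forall>(p, q)\<in>E0 square. c p q = c q p \<and> c p q > 0)"

definition quad_form :: "(real ^ 2 \<Rightarrow> real ^ 2 \<Rightarrow> real) \<Rightarrow> (real ^ 2 \<Rightarrow> real) \<Rightarrow> real" where
  "quad_form c g = (\<Sum>(p, q)\<in>E0 square. c p q * (g p - g q)\<^sup>2)"

definition energy_level :: "nat \<Rightarrow> (real ^ 2 \<Rightarrow> real ^ 2 \<Rightarrow> real) \<Rightarrow> (real ^ 2 \<Rightarrow> real) \<Rightarrow> real" where
  "energy_level n c f = (\<Sum>\<sigma>\<in>words n. quad_form c (f \<circ> sim_word square \<sigma>))"

text \<open>The infimum over functions on the first-level vertices extending \<open>f\<close>; functions are
  represented by total functions on the plane, of which only the relevant values matter.\<close>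

definition is_eigenform :: "(real ^ 2 \<Rightarrow> real ^ 2 \<Rightarrow> real) \<Rightarrow> real \<Rightarrow> bool" where
  "is_eigenform c \<rho> \<longleftrightarrow> is_conductance c \<and>
    (\<forall>f. Inf {energy_level 1 c g | g. \<forall>p\<in>V0 square. g p = f p} = \<rho> * quad_form c f)"

definition self_similar_energy ::
  "(real ^ 2 \<Rightarrow> real ^ 2 \<Rightarrow> real) \<Rightarrow> real \<Rightarrow> (real ^ 2 \<Rightarrow> real) \<Rightarrow> ennreal" where
  "self_similar_energy c \<rho> f = lim (\<lambda>n. ennreal ((1 / \<rho>) ^ n * energy_level n c f))"

definition finite_energy :: "(real ^ 2 \<Rightarrow> real) \<Rightarrow> bool" where
  "finite_energy f \<longleftrightarrow> continuous_on (fractal square) f \<and>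
    (\<exists>c \<rho>. is_eigenform c \<rho> \<and> self_similar_energy c \<rho> f < \<infinity>)"

text \<open>The conductances \<open>(1,1,1,1,H,1/H)\<close>; the diagonal joining vertices 1 and 3 is the one
  that \<open>to_rhombus \<theta>\<close> maps to the diagonal of length \<open>2 cos \<theta>\<close>.\<close>

definition vicsek_cond :: "real \<Rightarrow> real ^ 2 \<Rightarrow> real ^ 2 \<Rightarrow> real" where
  "vicsek_cond H p q =
    (if {p, q} = {pt square 1, pt square 3} then H
     else if {p, q} = {pt square 2, pt square 4} then 1 / H
     else 1)"

definition H_of :: "real \<Rightarrow> real" where
  "H_of \<theta> = (2 + sqrt (1 + (tan \<theta>)\<^sup>2)) / (2 + sqrt (1 + (cot \<theta>)\<^sup>2))"

end

theory Submission
  imports Defs "HOL-Real_Asymp.Real_Asymp"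
begin

text \<open>Modulo constants, a function on the four vertices of the square is a combination of three modes, which
  diagonalise every form with conductances \<open>(1,1,1,1,u,v)\<close>: up to a common factor the energies are
  \<open>1 + u\<close> and \<open>1 + v\<close> on the two diagonal modes and \<open>4\<close> on the alternating mode.
  For the eigenform, the increment of the renormalised energy from one level to the next controls the alternating
  mode up to a contraction; so for a function of bounded energy the renormalised level sums of the squared
  alternating mode tend to \<open>0\<close>, while those of the two diagonal modes converge, to \<open>P\<close> and \<open>Q\<close> say.
  The limiting energy is therefore a multiple of \<open>(1 + u) P + (1 + v) Q\<close>, and depends on the
  conductances up to scaling only through \<open>(1 + u) / (1 + v)\<close>, which equals \<open>H\<close> for
  \<open>(1,1,1,1,H,1/H)\<close>. At \<open>s = 1\<close> the zeta function has \<open>u = 1 / (2 cos \<theta>)\<close> and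
  \<open>v = 1 / (2 sin \<theta>)\<close>, and its residue is the Abel limit of the level energies divided by \<open>ln 3\<close>.\<close>

section \<open>Abel means\<close>

lemma summable_bounded_power:
  fixes b :: "nat \<Rightarrow> real"
  assumes "0 < x" "x < 1" "\<And>n. \<bar>b n\<bar> \<le> M"
  shows "summable (\<lambda>n. b n * x ^ n)"
proof (rule summable_comparison_test')
  show "summable (\<lambda>n. M * x ^ n)" using assms by (simp add: summable_geometric summable_mult)
  show "norm (b n * x ^ n) \<le> M * x ^ n" for n
    using assms by (simp add: abs_mult mult_right_mono)
qed

text \<open>The constant sequence L has Abel mean exactly L, so only the deviations \<open>d\<close>
  matter. Past N they are below e/2 while the weights (1 - x) x^n have total mass 1; the earlier
  ones contribute at most (1 - x) K, which vanishes as x tends to 1.\<close>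

lemma abel_mean_tendsto:
  fixes a :: "nat \<Rightarrow> real"
  assumes lim: "a \<longlonglongrightarrow> L"
  shows "((\<lambda>x. (1 - x) * (\<Sum>n. a n * x ^ n)) \<longlongrightarrow> L) (at_left 1)"
proof -
  define d where "d n = \<bar>a n - L\<bar>" for n
  have d0: "d \<longlonglongrightarrow> 0"
    unfolding d_def using lim by (simp add: LIM_zero tendsto_rabs_zero)
  obtain B where B: "\<And>n. \<bar>a n\<bar> \<le> B"
    using convergent_imp_Bseq[OF convergentI[OF lim]] by (auto simp: Bseq_def)
  have dB: "\<bar>d n\<bar> \<le> B + \<bar>L\<bar>" for n unfolding d_def using B[of n] by linarith
  show ?thesis
    unfolding tendsto_iff
  proof (intro allI impI)
    fix e :: real assume e: "e > 0"
    obtain N where N: "\<And>n. n \<ge> N \<Longrightarrow> d n < e / 2"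
      using LIMSEQ_D[OF d0, of "e/2"] e by (auto simp: d_def)
    define K where "K = (\<Sum>n<N. d n)"
    have "((\<lambda>x. (1 - x) * K) \<longlongrightarrow> (1 - 1) * K) (at_left (1::real))" by (intro tendsto_intros)
    then have "eventually (\<lambda>x. (1 - x) * K < e / 2) (at_left (1::real))"
      by (rule order_tendstoD) (use e in auto)
    moreover have "eventually (\<lambda>x. 0 < x \<and> x < 1) (at_left (1::real))"
      by (rule eventually_mono[OF eventually_at_left_real[of 0 1]]) auto
    ultimately show "eventually (\<lambda>x. dist ((1 - x) * (\<Sum>n. a n * x ^ n)) L < e) (at_left 1)"
    proof eventually_elim
      case (elim x)
      then have x: "0 < x" "x < 1" "(1 - x) * K < e / 2" by auto
      have geo: "summable (\<lambda>n. x ^ n)" "(\<Sum>n. x ^ n) = 1 / (1 - x)"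
        using x by (auto simp: suminf_geometric summable_geometric)
      have sa: "summable (\<lambda>n. a n * x ^ n)" using summable_bounded_power[OF x(1,2) B] .
      have sd: "summable (\<lambda>n. d n * x ^ n)" using summable_bounded_power[OF x(1,2) dB] .
      have "(\<Sum>n. a n * x ^ n) - L * (1 / (1 - x)) = (\<Sum>n. a n * x ^ n) - (\<Sum>n. L * x ^ n)"
        using geo by (simp add: suminf_mult)
      also have "\<dots> = (\<Sum>n. (a n - L) * x ^ n)"
        by (subst suminf_diff) (use sa geo in \<open>auto simp: summable_mult algebra_simps\<close>)
      finally have "\<bar>(\<Sum>n. a n * x ^ n) - L * (1 / (1 - x))\<bar> = \<bar>\<Sum>n. (a n - L) * x ^ n\<bar>" by simp
      also have "\<dots> \<le> (\<Sum>n. d n * x ^ n)"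
        using summable_rabs[of "\<lambda>n. (a n - L) * x ^ n"] sd x by (simp add: d_def abs_mult)
      also have "\<dots> = (\<Sum>n. d (n + N) * x ^ (n + N)) + (\<Sum>n<N. d n * x ^ n)"
        using suminf_split_initial_segment[OF sd, of N] by simp
      also have "\<dots> \<le> e / 2 * (1 / (1 - x)) + K"
      proof (rule add_mono)
        have "(\<Sum>n. d (n + N) * x ^ (n + N)) \<le> (\<Sum>n. e / 2 * x ^ n)"
        proof (rule suminf_le)
          fix n
          have "x ^ (n + N) \<le> x ^ n" using x by (intro power_decreasing) auto
          then show "d (n + N) * x ^ (n + N) \<le> e / 2 * x ^ n"
            using N[of "n + N"] x by (intro mult_mono) (use e in \<open>auto simp: d_def\<close>)
        qed (use sd geo in \<open>auto simp: summable_iff_shift[of "\<lambda>n. d n * x ^ n"] summable_mult\<close>)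
        then show "(\<Sum>n. d (n + N) * x ^ (n + N)) \<le> e / 2 * (1 / (1 - x))"
          by (simp only: suminf_mult[OF geo(1)] geo(2))
        show "(\<Sum>n<N. d n * x ^ n) \<le> K" unfolding K_def
          using x by (intro sum_mono mult_left_le) (auto simp: d_def power_le_one)
      qed
      finally have 1: "\<bar>(\<Sum>n. a n * x ^ n) - L * (1 / (1 - x))\<bar> \<le> e / 2 * (1 / (1 - x)) + K" .
      have "dist ((1 - x) * (\<Sum>n. a n * x ^ n)) L = (1 - x) * \<bar>(\<Sum>n. a n * x ^ n) - L * (1 / (1 - x))\<bar>"
      proof -
        have "(1 - x) * (\<Sum>n. a n * x ^ n) - L = (1 - x) * ((\<Sum>n. a n * x ^ n) - L * (1 / (1 - x)))"
          using x by (simp add: field_simps)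
        then show ?thesis using x by (simp add: dist_real_def abs_mult)
      qed
      also have "\<dots> \<le> (1 - x) * (e / 2 * (1 / (1 - x)) + K)"
        using 1 x by (intro mult_left_mono) auto
      also have "\<dots> = e / 2 + (1 - x) * K"
      proof -
        have "y * (e / 2 * (1 / y)) = e / 2" if "y \<noteq> 0" for y using that by simp
        from this[of "1 - x"] show ?thesis using x by (simp only: distrib_left)
      qed
      also have "\<dots> < e" using x by simp
      finally show ?case .
    qed
  qed
qed

text \<open>Substitute x = 3^(1 - s): it tends to 1 from below as s decreases to 1, and (s - 1) / (1
  - x) tends to 1 / ln 3. This is where the factor ln 3 of the residue comes from.\<close>

lemma abel_residue:
  fixes a :: "nat \<Rightarrow> real"
  assumes "a \<longlonglongrightarrow> L"
  shows "((\<lambda>s. (s - 1) * (\<Sum>n. a n * (3 powr (1 - s)) ^ n)) \<longlongrightarrow> L / ln 3) (at_right 1)"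
proof -
  have "((\<lambda>s::real. (s - 1) / (1 - 3 powr (1 - s))) \<longlongrightarrow> inverse (ln 3)) (at_right 1)"
    by real_asymp
  moreover have "filterlim (\<lambda>s::real. 3 powr (1 - s)) (at_left 1) (at_right 1)"
    by real_asymp
  from filterlim_compose[OF abel_mean_tendsto[OF assms] this]
  have "((\<lambda>s. (1 - 3 powr (1 - s)) * (\<Sum>n. a n * (3 powr (1 - s)) ^ n)) \<longlongrightarrow> L) (at_right 1)" .
  ultimately have "((\<lambda>s. (s - 1) / (1 - 3 powr (1 - s)) * ((1 - 3 powr (1 - s)) *
      (\<Sum>n. a n * (3 powr (1 - s)) ^ n))) \<longlongrightarrow> inverse (ln 3) * L) (at_right 1)"
    by (rule tendsto_mult)
  moreover have "eventually (\<lambda>s::real. s > 1) (at_right 1)"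
    by (simp add: eventually_at_right_less)
  then have "eventually (\<lambda>s. (s - 1) / (1 - 3 powr (1 - s)) * ((1 - 3 powr (1 - s)) *
      (\<Sum>n. a n * (3 powr (1 - s)) ^ n)) = (s - 1) * (\<Sum>n. a n * (3 powr (1 - s)) ^ n)) (at_right 1)"
    by eventually_elim simp
  ultimately have "((\<lambda>s. (s - 1) * (\<Sum>n. a n * (3 powr (1 - s)) ^ n)) \<longlongrightarrow> inverse (ln 3) * L) (at_right 1)"
    by (rule Lim_transform_eventually)
  then show ?thesis by (simp add: field_simps)
qed

section \<open>Vertices and modes of the square\<close>

lemma pt_simps: "pt \<theta> (Suc 0) = vector [cos \<theta>, 0]" "pt \<theta> 1 = vector [cos \<theta>, 0]"
  "pt \<theta> 2 = vector [0, sin \<theta>]" "pt \<theta> 3 = vector [- cos \<theta>, 0]"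
  "pt \<theta> 4 = vector [0, - sin \<theta>]" "pt \<theta> 5 = 0"
  by (simp_all add: pt_def)

lemma atLeastAtMost_1_4: "{1..4} = {1, 2, 3, 4 :: nat}"
  by auto

lemma atLeastAtMost_1_5: "{1..5} = {1, 2, 3, 4, 5 :: nat}"
  by auto

lemma sum_1_4: "(\<Sum>i\<in>{1..4::nat}. h i) = h 1 + h 2 + h 3 + h 4" for h :: "nat \<Rightarrow> real"
  unfolding atLeastAtMost_1_4 by simp

lemma sum_1_5: "(\<Sum>i\<in>{1..5::nat}. h i) = h 1 + h 2 + h 3 + h 4 + h 5" for h :: "nat \<Rightarrow> real"
  unfolding atLeastAtMost_1_5 by simp

lemma pt_eq_iff:
  assumes "0 < \<theta>" "\<theta> < pi / 2" "i \<in> {1..4}" "j \<in> {1..4}"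
  shows "pt \<theta> i = pt \<theta> j \<longleftrightarrow> i = j"
proof -
  have "cos \<theta> > 0" "sin \<theta> > 0" using assms by (auto intro: cos_gt_zero sin_gt_zero2)
  then show ?thesis using assms(3,4) unfolding atLeastAtMost_1_4
    by (elim insertE emptyE) (simp_all add: pt_simps vec_eq_iff forall_2)
qed

lemma V0_eq: "V0 \<theta> = {pt \<theta> 1, pt \<theta> 2, pt \<theta> 3, pt \<theta> 4}"
  unfolding V0_def atLeastAtMost_1_4 by simp

lemma finite_E0: "finite (E0 \<theta>)"
proof (rule finite_subset)
  show "E0 \<theta> \<subseteq> V0 \<theta> \<times> V0 \<theta>" by (auto simp: E0_def)
qed (simp add: V0_def)

lemma sum_E0:
  fixes h :: "real ^ 2 \<Rightarrow> real ^ 2 \<Rightarrow> real"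
  assumes "0 < \<theta>" "\<theta> < pi / 2"
  shows "(\<Sum>(p, q)\<in>E0 \<theta>. h p q) =
    h (pt \<theta> 1) (pt \<theta> 2) + h (pt \<theta> 1) (pt \<theta> 3) + h (pt \<theta> 1) (pt \<theta> 4) +
    h (pt \<theta> 2) (pt \<theta> 1) + h (pt \<theta> 2) (pt \<theta> 3) + h (pt \<theta> 2) (pt \<theta> 4) +
    h (pt \<theta> 3) (pt \<theta> 1) + h (pt \<theta> 3) (pt \<theta> 2) + h (pt \<theta> 3) (pt \<theta> 4) +
    h (pt \<theta> 4) (pt \<theta> 1) + h (pt \<theta> 4) (pt \<theta> 2) + h (pt \<theta> 4) (pt \<theta> 3)"
proof -
  define V where "V = [pt \<theta> 1, pt \<theta> 2, pt \<theta> 3, pt \<theta> 4]"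
  have "E0 \<theta> = (SIGMA p:V0 \<theta>. V0 \<theta> - {p})" by (auto simp: E0_def)
  then have "(\<Sum>(p, q)\<in>E0 \<theta>. h p q) = (\<Sum>p\<in>V0 \<theta>. \<Sum>q\<in>V0 \<theta> - {p}. h p q)"
    by (simp add: sum.Sigma V0_def)
  also have "\<dots> = (\<Sum>p\<in>V0 \<theta>. (\<Sum>q\<in>V0 \<theta>. h p q) - h p p)"
    by (intro sum.cong) (auto simp: sum_diff1 V0_def)
  finally show ?thesis
    by (simp add: V0_eq pt_eq_iff[OF assms])
qed

lemma square_range: "0 < square" "square < pi / 2"
  using pi_gt_zero by auto

definition mode1 :: "(real ^ 2 \<Rightarrow> real) \<Rightarrow> real" where
  "mode1 g = (g (pt square 1) - g (pt square 3)) / 2"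

definition mode2 :: "(real ^ 2 \<Rightarrow> real) \<Rightarrow> real" where
  "mode2 g = (g (pt square 2) - g (pt square 4)) / 2"

definition mode3 :: "(real ^ 2 \<Rightarrow> real) \<Rightarrow> real" where
  "mode3 g = (g (pt square 1) - g (pt square 2) + g (pt square 3) - g (pt square 4)) / 4"

text \<open>The outer 2 counts both orientations of an edge. Each diagonal sees only its own mode,
  whereas the four sides together contribute 4 to either diagonal mode and 16 to the alternating
  one.\<close>

definition mode_energy :: "real \<Rightarrow> real \<Rightarrow> (real ^ 2 \<Rightarrow> real) \<Rightarrow> real" where
  "mode_energy u v g = 2 * (4 * (1 + u) * (mode1 g)\<^sup>2 + 4 * (1 + v) * (mode2 g)\<^sup>2 + 16 * (mode3 g)\<^sup>2)"

lemma mode_energy_vertices: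
  "mode_energy u v g =
    2 * ((g (pt square 1) - g (pt square 2))\<^sup>2 + (g (pt square 2) - g (pt square 3))\<^sup>2 +
      (g (pt square 3) - g (pt square 4))\<^sup>2 + (g (pt square 4) - g (pt square 1))\<^sup>2 +
      u * (g (pt square 1) - g (pt square 3))\<^sup>2 + v * (g (pt square 2) - g (pt square 4))\<^sup>2)"
  unfolding mode_energy_def mode1_def mode2_def mode3_def power2_eq_square by (simp add: field_simps)

lemma quad_form_vicsek: "quad_form (vicsek_cond H) g = mode_energy H (1 / H) g"
  unfolding quad_form_def sum_E0[OF square_range] mode_energy_vertices
  by (simp add: vicsek_cond_def doubleton_eq_iff pt_eq_iff[OF square_range] power2_eq_square algebra_simps)

lemma is_conductance_vicsek:
  assumes "H > 0"
  shows "is_conductance (vicsek_cond H)"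
  using assms by (auto simp: is_conductance_def vicsek_cond_def insert_commute)

section \<open>Forms with arbitrary positive conductances\<close>

lemma conductance_term_nonneg:
  assumes "is_conductance c" "(p, q) \<in> E0 square"
  shows "c p q * (g p - g q)\<^sup>2 \<ge> 0"
  using assms by (intro mult_nonneg_nonneg) (auto simp: is_conductance_def intro: less_imp_le)

lemma quad_form_nonneg:
  assumes "is_conductance c"
  shows "quad_form c g \<ge> 0"
  unfolding quad_form_def using conductance_term_nonneg[OF assms] by (intro sum_nonneg) auto

lemma quad_form_affine:
  assumes "\<And>i. i \<in> {1..4} \<Longrightarrow> g (pt square i) = a + t * h (pt square i)"
  shows "quad_form c g = t\<^sup>2 * quad_form c h"
proof -
  have eq: "g p = a + t * h p" if "p \<in> V0 square" for p
    using assms that by (auto simp: V0_def)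
  show ?thesis
    unfolding quad_form_def sum_distrib_left
  proof (rule sum.cong[OF refl], clarify)
    fix p q assume "(p, q) \<in> E0 square"
    then have "g p - g q = t * (h p - h q)" by (auto simp: E0_def eq algebra_simps)
    then show "c p q * (g p - g q)\<^sup>2 = t\<^sup>2 * (c p q * (h p - h q)\<^sup>2)" by (simp add: power_mult_distrib)
  qed
qed

text \<open>The two orientations of one diagonal give the factor 2; the other ten terms are
  nonnegative and are dropped.\<close>

lemma quad_form_ge_diagonal:
  assumes c: "is_conductance c"
  shows "quad_form c g \<ge> 2 * c (pt square 1) (pt square 3) * (g (pt square 1) - g (pt square 3))\<^sup>2"
proof -
  note pos = conductance_term_nonneg[OF c, where g = g]
  have E: "(pt square i, pt square j) \<in> E0 square"
    if "(i, j) \<in> {(1,2),(1,3),(1,4),(2,1),(2,3),(2,4),(3,1),(3,2),(3,4),(4,1),(4,2),(4,3)}" for i j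
    using that by (auto simp: E0_def V0_eq pt_eq_iff[OF square_range])
  have "c (pt square 3) (pt square 1) = c (pt square 1) (pt square 3)"
    using c E[of 1 3] by (auto simp: is_conductance_def)
  then show ?thesis
    using pos[OF E, of 1 2] pos[OF E, of 1 4] pos[OF E, of 2 1] pos[OF E, of 2 3] pos[OF E, of 2 4]
      pos[OF E, of 3 2] pos[OF E, of 3 4] pos[OF E, of 4 1] pos[OF E, of 4 2] pos[OF E, of 4 3]
    unfolding quad_form_def sum_E0[OF square_range] power2_commute[of "g (pt square 3)" "g (pt square 1)"]
    by simp
qed

text \<open>The sum of all conductance ratios dominates each single ratio, so the comparison holds
  edge by edge. It carries bounds from an unknown eigenform over to the forms
  \<open>vicsek_cond\<close>.\<close>

lemma quad_form_comparable:
  assumes c: "is_conductance c" and d: "is_conductance d"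
  obtains K where "K \<ge> 0" "\<And>g. quad_form d g \<le> K * quad_form c g"
proof
  define K where "K = (\<Sum>(p, q)\<in>E0 square. d p q / c p q)"
  have nn: "d p q / c p q \<ge> 0" if "(p, q) \<in> E0 square" for p q
    using c d that by (fastforce simp: is_conductance_def intro!: divide_nonneg_nonneg)
  show "K \<ge> 0" unfolding K_def using nn by (intro sum_nonneg) auto
  show "quad_form d g \<le> K * quad_form c g" for g
    unfolding quad_form_def sum_distrib_left
  proof (rule sum_mono, clarify)
    fix p q assume e: "(p, q) \<in> E0 square"
    have "d p q / c p q \<le> K" unfolding K_def
      using member_le_sum[OF e, of "\<lambda>(p, q). d p q / c p q"] nn finite_E0 by auto
    moreover have "c p q > 0" using c e by (auto simp: is_conductance_def)
    ultimately have "d p q \<le> K * c p q" by (simp add: field_simps)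
    then show "d p q * (g p - g q)\<^sup>2 \<le> K * (c p q * (g p - g q)\<^sup>2)"
      by (metis mult.assoc mult_right_mono zero_le_power2)
  qed
qed

section \<open>Level sums\<close>

lemma finite_words: "finite (words n)"
  unfolding words_def by (rule finite_lists_length_eq) simp

lemma words_0: "words 0 = {[]}"
  by (auto simp: words_def)

lemma sum_words_Suc: "(\<Sum>\<sigma>\<in>words (Suc n). h \<sigma>) = (\<Sum>\<sigma>\<in>words n. \<Sum>i\<in>{1..5}. h (\<sigma> @ [i]))"
proof -
  have "words (Suc n) = (\<lambda>(\<sigma>, i). \<sigma> @ [i]) ` (words n \<times> {1..5})"
  proof (intro equalityI subsetI)
    fix \<tau> assume "\<tau> \<in> words (Suc n)"
    then show "\<tau> \<in> (\<lambda>(\<sigma>, i). \<sigma> @ [i]) ` (words n \<times> {1..5})"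
      by (cases \<tau> rule: rev_cases) (auto simp: words_def)
  qed (auto simp: words_def)
  moreover have "inj_on (\<lambda>(\<sigma>, i). \<sigma> @ [i]) (words n \<times> {1..5})" by (auto simp: inj_on_def)
  ultimately show ?thesis
    by (simp add: sum.reindex sum.cartesian_product case_prod_unfold comp_def)
qed

lemma sim_word_Nil: "sim_word \<theta> [] = id"
  by (simp add: sim_word_def)

lemma sim_word_snoc: "sim_word \<theta> (\<sigma> @ [i]) = sim_word \<theta> \<sigma> \<circ> sim \<theta> i"
  by (induction \<sigma>) (auto simp: sim_word_def)

lemma energy_level_1: "energy_level 1 c g = (\<Sum>i\<in>{1..5}. quad_form c (g \<circ> sim square i))"
  by (simp add: energy_level_def sum_words_Suc words_0 sim_word_snoc[of _ "[]", simplified] sim_word_Nil)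

text \<open>The factor \<open>3 ^ n\<close> is the renormalisation for the eigenvalue 1/3. The
  functional \<open>q\<close> is an argument so that total energies and squares of single modes are
  handled by the same lemmas.\<close>

definition level_sum :: "nat \<Rightarrow> ((real ^ 2 \<Rightarrow> real) \<Rightarrow> real) \<Rightarrow> (real ^ 2 \<Rightarrow> real) \<Rightarrow> real" where
  "level_sum n q f = 3 ^ n * (\<Sum>\<sigma>\<in>words n. q (f \<circ> sim_word square \<sigma>))"

text \<open>The last letter of a word is the innermost map, so level n + 1 subdivides every cell of
  level n. A one-step inequality valid for all functions therefore passes to every level.\<close>

lemma level_sum_Suc:
  "level_sum (Suc n) q f = level_sum n (\<lambda>g. 3 * (\<Sum>i\<in>{1..5}. q (g \<circ> sim square i))) f"
  by (simp add: level_sum_def sum_words_Suc sim_word_snoc comp_assoc sum_distrib_left mult.assoc mult.left_commute)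

lemma level_sum_mono:
  assumes "\<And>g. q g \<le> r g"
  shows "level_sum n q f \<le> level_sum n r f"
  unfolding level_sum_def using assms by (intro mult_left_mono sum_mono) auto

lemma level_sum_nonneg:
  assumes "\<And>g. q g \<ge> 0"
  shows "level_sum n q f \<ge> 0"
  unfolding level_sum_def using assms by (intro mult_nonneg_nonneg sum_nonneg) auto

lemma level_sum_cmult: "level_sum n (\<lambda>g. K * q g) f = K * level_sum n q f"
  by (simp add: level_sum_def sum_distrib_left mult.left_commute)

lemma level_sum_add: "level_sum n (\<lambda>g. q g + r g) f = level_sum n q f + level_sum n r f"
  by (simp add: level_sum_def sum.distrib distrib_left)

lemma level_sum_mode_energy:
  "level_sum n (mode_energy u v) f =
    2 * (4 * (1 + u) * level_sum n (\<lambda>g. (mode1 g)\<^sup>2) f + 4 * (1 + v) * level_sum n (\<lambda>g. (mode2 g)\<^sup>2) f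
      + 16 * level_sum n (\<lambda>g. (mode3 g)\<^sup>2) f)"
  unfolding mode_energy_def[abs_def] by (simp only: level_sum_cmult level_sum_add)

lemma sim_vertex: "sim \<theta> i (pt \<theta> i) = pt \<theta> i"
  by (simp add: sim_def)

text \<open>These are the only contacts between first-level cells: the vertex of corner cell i
  opposite to i is vertex i of the central cell.\<close>

lemma sim_inner_vertex:
  "sim \<theta> 1 (pt \<theta> 3) = sim \<theta> 5 (pt \<theta> 1)" "sim \<theta> 2 (pt \<theta> 4) = sim \<theta> 5 (pt \<theta> 2)"
  "sim \<theta> 3 (pt \<theta> 1) = sim \<theta> 5 (pt \<theta> 3)" "sim \<theta> 4 (pt \<theta> 2) = sim \<theta> 5 (pt \<theta> 4)"
  by (simp_all add: sim_def pt_simps vec_eq_iff forall_2)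

section \<open>One renormalisation step\<close>

text \<open>The corner cells have disjoint vertex sets, so their vertex values can be prescribed
  freely; every vertex of the central cell belongs to one of them. \<open>reg\<close> recognises the
  corner cell from the cone, bounded by the lines |x1| = |x2|, that contains the point, and 3 x - 2
  p inverts the similitude with fixed point p.\<close>

lemma glue_corner_cells:
  fixes k :: "nat \<Rightarrow> nat \<Rightarrow> real"
  obtains g where "\<And>i j. i \<in> {1..4} \<Longrightarrow> j \<in> {1..4} \<Longrightarrow> g (sim square i (pt square j)) = k i j"
proof
  define reg :: "real ^ 2 \<Rightarrow> nat" where
    "reg x = (if x $ 1 > \<bar>x $ 2\<bar> then 1 else if x $ 2 > \<bar>x $ 1\<bar> then 2 else if - x $ 1 > \<bar>x $ 2\<bar> then 3 else 4)" for x
  define g where "g x = k (reg x) (inv_into {1..4} (pt square) (3 *\<^sub>R x - 2 *\<^sub>R pt square (reg x)))" for x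
  fix i j :: nat assume i: "i \<in> {1..4}" and j: "j \<in> {1..4}"
  have c: "cos square > 0" "sin square = cos square" by (simp_all add: cos_45 sin_45)
  have "reg (sim square i (pt square j)) = i"
    using i j c(1) unfolding atLeastAtMost_1_4
    by (elim insertE emptyE) (simp_all add: reg_def sim_def pt_simps c(2) del: cos_45 sin_45)
  moreover have "3 *\<^sub>R sim square i (pt square j) - 2 *\<^sub>R pt square i = pt square j"
    by (simp add: sim_def vec_eq_iff algebra_simps)
  moreover have "inj_on (pt square) {1..4}"
    using pt_eq_iff[OF square_range] by (auto simp: inj_on_def)
  ultimately show "g (sim square i (pt square j)) = k i j"
    using j by (simp add: g_def inv_into_f_f)
qed

text \<open>Here x are the outer values and y those on the central cell. Up to the factor 2 for
  orientations, the left side is three times the least energy of the five cells for given x and y: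
  in a corner cell the two free vertices can be chosen so that only the diagonal mode is left. The
  right side is the energy of x plus squares. Eliminating \<delta> leaves 4 (1 + H) (1 + K) / (2 + H
  + K) as the coefficient of (\<gamma> - \<gamma>')^2, which is 4 exactly because H K = 1; hence the
  alternating mode renormalises with the same factor as the diagonal ones.\<close>

lemma vertex_gap_identity:
  fixes H K x1 x2 x3 x4 y1 y2 y3 y4 :: real
  assumes "H * K = 1"
  defines "\<gamma> \<equiv> (x1 - x2 + x3 - x4) / 4" and "\<gamma>' \<equiv> (y1 - y2 + y3 - y4) / 4"
    and "\<delta> \<equiv> (x1 + x2 + x3 + x4) / 4 - (y1 + y2 + y3 + y4) / 4"
  shows "3 * ((1 + H) * (x1 - y1)\<^sup>2 + (1 + H) * (x3 - y3)\<^sup>2 + (1 + K) * (x2 - y2)\<^sup>2 + (1 + K) * (x4 - y4)\<^sup>2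
      + ((1 + H) * (y1 - y3)\<^sup>2 + (1 + K) * (y2 - y4)\<^sup>2 + 16 * \<gamma>'\<^sup>2))
    = ((1 + H) * (x1 - x3)\<^sup>2 + (1 + K) * (x2 - x4)\<^sup>2 + 16 * \<gamma>\<^sup>2)
      + (1 + H) / 2 * (x1 - x3 - 3 * (y1 - y3))\<^sup>2 + (1 + K) / 2 * (x2 - x4 - 3 * (y2 - y4))\<^sup>2
      + 8 * (\<gamma> - 3 * \<gamma>')\<^sup>2 + 6 * K * ((1 + H) * \<delta> + (H - 1) * (\<gamma> - \<gamma>'))\<^sup>2"
proof -
  define \<alpha> \<alpha>' \<beta> \<beta>' \<epsilon> where "\<alpha> = (x1 - x3) / 2" and "\<alpha>' = (y1 - y3) / 2"
    and "\<beta> = (x2 - x4) / 2" and "\<beta>' = (y2 - y4) / 2" and "\<epsilon> = \<gamma> - \<gamma>'"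
  have d: "x1 - y1 = (\<delta> + \<epsilon>) + (\<alpha> - \<alpha>')" "x3 - y3 = (\<delta> + \<epsilon>) - (\<alpha> - \<alpha>')"
    "x2 - y2 = (\<delta> - \<epsilon>) + (\<beta> - \<beta>')" "x4 - y4 = (\<delta> - \<epsilon>) - (\<beta> - \<beta>')"
    "x1 - x3 = 2 * \<alpha>" "x2 - x4 = 2 * \<beta>" "y1 - y3 = 2 * \<alpha>'" "y2 - y4 = 2 * \<beta>'"
    unfolding \<alpha>_def \<alpha>'_def \<beta>_def \<beta>'_def \<epsilon>_def \<gamma>_def \<gamma>'_def \<delta>_def by (simp_all add: field_simps)
  have sq: "(s + t)\<^sup>2 + (s - t)\<^sup>2 = 2 * s\<^sup>2 + 2 * t\<^sup>2" for s t :: real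
    by (simp add: power2_eq_square algebra_simps)
  have dir: "3 * (2 * (t - t')\<^sup>2 + (2 * t')\<^sup>2) = (2 * t)\<^sup>2 + (2 * t - 3 * (2 * t'))\<^sup>2 / 2" for t t' :: real
    by (simp add: power2_eq_square field_simps)
  \<comment> \<open>The products \<open>H * K\<close> are left unevaluated: this equality replaces
    them by 1, and the following one is then a polynomial identity that completes the
    square.\<close>
  have "6 * ((1 + H) * (\<delta> + \<epsilon>)\<^sup>2 + (1 + K) * (\<delta> - \<epsilon>)\<^sup>2) =
      6 * ((K + 2 * (H * K) + (H * K) * H) * \<delta>\<^sup>2 + 2 * ((H * K) * H - K) * \<delta> * \<epsilon>
        + ((H * K) * H - 2 * (H * K) + K) * \<epsilon>\<^sup>2) + 24 * \<epsilon>\<^sup>2"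
    unfolding assms(1) by (simp add: power2_eq_square algebra_simps)
  also have "\<dots> = 6 * K * ((1 + H) * \<delta> + (H - 1) * \<epsilon>)\<^sup>2 + 24 * \<epsilon>\<^sup>2"
    by (simp add: power2_eq_square algebra_simps)
  finally have cross: "6 * ((1 + H) * (\<delta> + \<epsilon>)\<^sup>2 + (1 + K) * (\<delta> - \<epsilon>)\<^sup>2) =
      6 * K * ((1 + H) * \<delta> + (H - 1) * \<epsilon>)\<^sup>2 + 24 * \<epsilon>\<^sup>2" .
  have centre: "24 * \<epsilon>\<^sup>2 + 48 * \<gamma>'\<^sup>2 = 16 * \<gamma>\<^sup>2 + 8 * (\<gamma> - 3 * \<gamma>')\<^sup>2"
    unfolding \<epsilon>_def by (simp add: power2_eq_square algebra_simps)
  have "3 * ((1 + H) * (x1 - y1)\<^sup>2 + (1 + H) * (x3 - y3)\<^sup>2 + (1 + K) * (x2 - y2)\<^sup>2 + (1 + K) * (x4 - y4)\<^sup>2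
      + ((1 + H) * (y1 - y3)\<^sup>2 + (1 + K) * (y2 - y4)\<^sup>2 + 16 * \<gamma>'\<^sup>2))
    = 3 * ((1 + H) * ((x1 - y1)\<^sup>2 + (x3 - y3)\<^sup>2) + (1 + K) * ((x2 - y2)\<^sup>2 + (x4 - y4)\<^sup>2)
      + (1 + H) * (y1 - y3)\<^sup>2 + (1 + K) * (y2 - y4)\<^sup>2) + 48 * \<gamma>'\<^sup>2"
    by (simp add: distrib_left)
  also have "\<dots> = (1 + H) * (3 * (2 * (\<alpha> - \<alpha>')\<^sup>2 + (2 * \<alpha>')\<^sup>2)) + (1 + K) * (3 * (2 * (\<beta> - \<beta>')\<^sup>2 + (2 * \<beta>')\<^sup>2))
      + 6 * ((1 + H) * (\<delta> + \<epsilon>)\<^sup>2 + (1 + K) * (\<delta> - \<epsilon>)\<^sup>2) + 48 * \<gamma>'\<^sup>2"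
    unfolding d sq by (simp add: distrib_left)
  also have "\<dots> = (1 + H) * ((2 * \<alpha>)\<^sup>2 + (2 * \<alpha> - 3 * (2 * \<alpha>'))\<^sup>2 / 2) + (1 + K) * ((2 * \<beta>)\<^sup>2 + (2 * \<beta> - 3 * (2 * \<beta>'))\<^sup>2 / 2)
      + 6 * K * ((1 + H) * \<delta> + (H - 1) * \<epsilon>)\<^sup>2 + (16 * \<gamma>\<^sup>2 + 8 * (\<gamma> - 3 * \<gamma>')\<^sup>2)"
    unfolding dir cross centre[symmetric] by simp
  finally show ?thesis
    unfolding d \<epsilon>_def[symmetric] by (simp add: distrib_left)
qed

lemma quarter_square: "4 * c * (t / 2)\<^sup>2 = c * (t :: real)\<^sup>2"
  by (simp add: power_divide)

text \<open>This is the eigenvalue inequality with a remainder that controls the alternating mode.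
  In each corner cell the diagonal mode through the outer vertex and the alternating mode are kept,
  the latter giving 96 = 3 * 2 * 16; of the squares in \<open>vertex_gap_identity\<close> only the
  one comparing alternating modes is kept, giving 16 = 2 * 8.\<close>

lemma mode_energy_gap:
  assumes H: "H > 0"
  shows "mode_energy H (1 / H) g + 96 * (\<Sum>i\<in>{1..4}. (mode3 (g \<circ> sim square i))\<^sup>2)
      + 16 * (mode3 g - 3 * mode3 (g \<circ> sim square 5))\<^sup>2
    \<le> 3 * (\<Sum>i\<in>{1..5}. mode_energy H (1 / H) (g \<circ> sim square i))"
proof -
  define K where "K = 1 / H"
  have K: "H * K = 1" "K > 0" using H by (auto simp: K_def)
  have ge1: "mode_energy H K h \<ge> 2 * ((1 + H) * (4 * (mode1 h)\<^sup>2) + 16 * (mode3 h)\<^sup>2)"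
    and ge2: "mode_energy H K h \<ge> 2 * ((1 + K) * (4 * (mode2 h)\<^sup>2) + 16 * (mode3 h)\<^sup>2)" for h
  proof -
    have "(1 + H) * (mode1 h)\<^sup>2 \<ge> 0" "(1 + K) * (mode2 h)\<^sup>2 \<ge> 0" using H K by auto
    then show "mode_energy H K h \<ge> 2 * ((1 + H) * (4 * (mode1 h)\<^sup>2) + 16 * (mode3 h)\<^sup>2)"
      "mode_energy H K h \<ge> 2 * ((1 + K) * (4 * (mode2 h)\<^sup>2) + 16 * (mode3 h)\<^sup>2)"
      unfolding mode_energy_def mult.assoc mult.left_commute[of "1 + H" 4] mult.left_commute[of "1 + K" 4]
      by auto
  qed
  define x y where "x i = g (pt square i)" and "y i = g (sim square 5 (pt square i))" for i
  have m: "4 * (mode1 (g \<circ> sim square 1))\<^sup>2 = (x 1 - y 1)\<^sup>2" "4 * (mode2 (g \<circ> sim square 2))\<^sup>2 = (x 2 - y 2)\<^sup>2"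
    "4 * (mode1 (g \<circ> sim square 3))\<^sup>2 = (x 3 - y 3)\<^sup>2" "4 * (mode2 (g \<circ> sim square 4))\<^sup>2 = (x 4 - y 4)\<^sup>2"
    unfolding mode1_def mode2_def comp_def sim_vertex sim_inner_vertex x_def y_def
    by (simp_all add: power_divide power2_commute)
  have c: "mode_energy H K (g \<circ> sim square 5) = 2 * ((1 + H) * (y 1 - y 3)\<^sup>2 + (1 + K) * (y 2 - y 4)\<^sup>2
      + 16 * ((y 1 - y 2 + y 3 - y 4) / 4)\<^sup>2)"
    and b: "mode_energy H K g = 2 * ((1 + H) * (x 1 - x 3)\<^sup>2 + (1 + K) * (x 2 - x 4)\<^sup>2
      + 16 * ((x 1 - x 2 + x 3 - x 4) / 4)\<^sup>2)"
    unfolding mode_energy_def mode1_def mode2_def mode3_def quarter_square by (simp_all add: x_def y_def)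
  have nn: "(1 + H) / 2 * (x 1 - x 3 - 3 * (y 1 - y 3))\<^sup>2 \<ge> 0" "(1 + K) / 2 * (x 2 - x 4 - 3 * (y 2 - y 4))\<^sup>2 \<ge> 0"
    "6 * K * t\<^sup>2 \<ge> 0" for t using H K by auto
  have s: "mode3 g - 3 * mode3 (g \<circ> sim square 5)
      = (x 1 - x 2 + x 3 - x 4) / 4 - 3 * ((y 1 - y 2 + y 3 - y 4) / 4)"
    by (simp add: mode3_def x_def y_def)
  define z where "z i = 16 * (mode3 (g \<circ> sim square i))\<^sup>2" for i
  have "mode_energy H K (g \<circ> sim square 1) \<ge> 2 * ((1 + H) * (x 1 - y 1)\<^sup>2 + z 1)"
    "mode_energy H K (g \<circ> sim square 2) \<ge> 2 * ((1 + K) * (x 2 - y 2)\<^sup>2 + z 2)"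
    "mode_energy H K (g \<circ> sim square 3) \<ge> 2 * ((1 + H) * (x 3 - y 3)\<^sup>2 + z 3)"
    "mode_energy H K (g \<circ> sim square 4) \<ge> 2 * ((1 + K) * (x 4 - y 4)\<^sup>2 + z 4)"
    using ge1[of "g \<circ> sim square 1"] ge2[of "g \<circ> sim square 2"] ge1[of "g \<circ> sim square 3"] ge2[of "g \<circ> sim square 4"]
    by (simp_all only: m z_def)
  moreover have "96 * (\<Sum>i\<in>{1..4}. (mode3 (g \<circ> sim square i))\<^sup>2) = 6 * (z 1 + z 2 + z 3 + z 4)"
    unfolding sum_1_4 z_def by simp
  moreover have "(\<Sum>i\<in>{1..5}. mode_energy H K (g \<circ> sim square i)) =
      mode_energy H K (g \<circ> sim square 1) + mode_energy H K (g \<circ> sim square 2) + mode_energy H K (g \<circ> sim square 3)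
      + mode_energy H K (g \<circ> sim square 4) + mode_energy H K (g \<circ> sim square 5)"
    by (rule sum_1_5)
  \<comment> \<open>With all squares abstracted to real atoms the claim is linear: six times the
    cell bounds' main parts is twice the gap identity, and \<open>n1\<close>, \<open>n2\<close>,
    \<open>n3\<close> are dropped.\<close>
  moreover have "2 * B + 6 * (z1 + z2 + z3 + z4) + 16 * S \<le> 3 * (c1 + c2 + c3 + c4 + 2 * C)"
    if "c1 \<ge> 2 * (a1 + z1)" "c2 \<ge> 2 * (a2 + z2)" "c3 \<ge> 2 * (a3 + z3)" "c4 \<ge> 2 * (a4 + z4)"
      "3 * (a1 + a3 + a2 + a4 + C) = B + n1 + n2 + 8 * S + n3" "n1 \<ge> 0" "n2 \<ge> 0" "n3 \<ge> 0"
    for a1 a2 a3 a4 c1 c2 c3 c4 z1 z2 z3 z4 n1 n2 n3 B C S :: real using that unfolding distrib_left by linarith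
  note this[OF _ _ _ _ vertex_gap_identity[OF K(1), of "x 1" "y 1" "x 3" "y 3" "x 2" "y 2" "x 4" "y 4"] nn]
  ultimately show ?thesis
    unfolding K_def[symmetric] s b c by metis
qed

text \<open>The extension is chosen so that every extra square in \<open>vertex_gap_identity\<close>
  vanishes, which turns the lower bound into an equality.\<close>

lemma harmonic_extension:
  assumes H: "H > 0"
  obtains g where "\<And>p. p \<in> V0 square \<Longrightarrow> g p = f p"
    "(\<Sum>i\<in>{1..5}. mode_energy H (1 / H) (g \<circ> sim square i)) = 1 / 3 * mode_energy H (1 / H) f"
proof -
  define K where "K = 1 / H"
  have K: "H * K = 1" using H by (auto simp: K_def)
  define x where "x i = f (pt square i)" for i
  define \<alpha> \<beta> \<gamma> where "\<alpha> = (x 1 - x 3) / 2" and "\<beta> = (x 2 - x 4) / 2" and "\<gamma> = (x 1 - x 2 + x 3 - x 4) / 4"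
  \<comment> \<open>\<open>m\<close> is the mean over the central cell; it solves (1 + H) \<delta> +
    (H - 1) (\<gamma> - \<gamma> / 3) = 0, the equation checked in \<open>z4\<close>.\<close>
  define m where "m = (x 1 + x 2 + x 3 + x 4) / 4 + 2 * \<gamma> * (H - 1) / (3 * (1 + H))"
  \<comment> \<open>All three modes of the central cell are one third of those of the outer
    values.\<close>
  define y where "y i = (if i = (1::nat) then m + \<alpha> / 3 + \<gamma> / 3 else if i = 2 then m + \<beta> / 3 - \<gamma> / 3
      else if i = 3 then m - \<alpha> / 3 + \<gamma> / 3 else m - \<beta> / 3 - \<gamma> / 3)" for i
  \<comment> \<open>In corner cell i the two vertices off the diagonal through i take the average of
    its end values, so the other two modes of that cell are zero.\<close>
  define k where "k i j = (if j = i then x i else if i + 2 = j \<or> j + 2 = i then y i else (x i + y i) / 2)" for i j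
  obtain g where g: "\<And>i j. i \<in> {1..4} \<Longrightarrow> j \<in> {1..4} \<Longrightarrow> g (sim square i (pt square j)) = k i j"
    using glue_corner_cells[of k] by blast
  have gx: "g (pt square i) = x i" if "i \<in> {1..4}" for i
    using g[OF that that] by (simp add: sim_vertex k_def)
  have gy: "g (sim square 5 (pt square 1)) = y 1" "g (sim square 5 (pt square 2)) = y 2"
    "g (sim square 5 (pt square 3)) = y 3" "g (sim square 5 (pt square 4)) = y 4"
    using g[of 1 3] g[of 2 4] g[of 3 1] g[of 4 2] unfolding sim_inner_vertex by (auto simp: k_def)
  have cells: "mode_energy H K (g \<circ> sim square 1) = 2 * ((1 + H) * (x 1 - y 1)\<^sup>2)"
    "mode_energy H K (g \<circ> sim square 2) = 2 * ((1 + K) * (x 2 - y 2)\<^sup>2)"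
    "mode_energy H K (g \<circ> sim square 3) = 2 * ((1 + H) * (x 3 - y 3)\<^sup>2)"
    "mode_energy H K (g \<circ> sim square 4) = 2 * ((1 + K) * (x 4 - y 4)\<^sup>2)"
  proof -
    have modes: "mode1 (g \<circ> sim square 1) = (x 1 - y 1) / 2" "mode2 (g \<circ> sim square 1) = 0" "mode3 (g \<circ> sim square 1) = 0"
      "mode1 (g \<circ> sim square 2) = 0" "mode2 (g \<circ> sim square 2) = (x 2 - y 2) / 2" "mode3 (g \<circ> sim square 2) = 0"
      "mode1 (g \<circ> sim square 3) = (y 3 - x 3) / 2" "mode2 (g \<circ> sim square 3) = 0" "mode3 (g \<circ> sim square 3) = 0"
      "mode1 (g \<circ> sim square 4) = 0" "mode2 (g \<circ> sim square 4) = (y 4 - x 4) / 2" "mode3 (g \<circ> sim square 4) = 0"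
      by (simp_all add: mode1_def mode2_def mode3_def g k_def) (simp_all add: field_simps)
    show "mode_energy H K (g \<circ> sim square 1) = 2 * ((1 + H) * (x 1 - y 1)\<^sup>2)"
      "mode_energy H K (g \<circ> sim square 2) = 2 * ((1 + K) * (x 2 - y 2)\<^sup>2)"
      "mode_energy H K (g \<circ> sim square 3) = 2 * ((1 + H) * (x 3 - y 3)\<^sup>2)"
      "mode_energy H K (g \<circ> sim square 4) = 2 * ((1 + K) * (x 4 - y 4)\<^sup>2)"
      unfolding mode_energy_def modes by (simp_all add: power_divide power2_commute[of "y 3" "x 3"] power2_commute[of "y 4" "x 4"])
  qed
  have c: "mode_energy H K (g \<circ> sim square 5) = 2 * ((1 + H) * (y 1 - y 3)\<^sup>2 + (1 + K) * (y 2 - y 4)\<^sup>2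
      + 16 * ((y 1 - y 2 + y 3 - y 4) / 4)\<^sup>2)"
    unfolding mode_energy_def mode1_def mode2_def mode3_def quarter_square comp_def gy by simp
  have b: "mode_energy H K f = 2 * ((1 + H) * (x 1 - x 3)\<^sup>2 + (1 + K) * (x 2 - x 4)\<^sup>2 + 16 * ((x 1 - x 2 + x 3 - x 4) / 4)\<^sup>2)"
    unfolding mode_energy_def mode1_def mode2_def mode3_def quarter_square by (simp add: x_def)
  have z: "x 1 - x 3 - 3 * (y 1 - y 3) = 0" "x 2 - x 4 - 3 * (y 2 - y 4) = 0"
    "(y 1 - y 2 + y 3 - y 4) / 4 = \<gamma> / 3" "(y 1 + y 2 + y 3 + y 4) / 4 = m"
    by (simp_all add: y_def \<alpha>_def \<beta>_def \<gamma>_def)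
  have z4: "(1 + H) * ((x 1 + x 2 + x 3 + x 4) / 4 - m) + (H - 1) * (\<gamma> - \<gamma> / 3) = 0"
    using H by (simp add: m_def field_simps)
  have id: "3 * ((1 + H) * (x 1 - y 1)\<^sup>2 + (1 + H) * (x 3 - y 3)\<^sup>2 + (1 + K) * (x 2 - y 2)\<^sup>2 + (1 + K) * (x 4 - y 4)\<^sup>2
      + ((1 + H) * (y 1 - y 3)\<^sup>2 + (1 + K) * (y 2 - y 4)\<^sup>2 + 16 * ((y 1 - y 2 + y 3 - y 4) / 4)\<^sup>2))
    = (1 + H) * (x 1 - x 3)\<^sup>2 + (1 + K) * (x 2 - x 4)\<^sup>2 + 16 * ((x 1 - x 2 + x 3 - x 4) / 4)\<^sup>2"
    using vertex_gap_identity[OF K, of "x 1" "y 1" "x 3" "y 3" "x 2" "y 2" "x 4" "y 4"]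
    unfolding z \<gamma>_def[symmetric] z4 by simp
  have combine: "2 * a1 + 2 * a2 + 2 * a3 + 2 * a4 + 2 * C = 1 / 3 * (2 * B)"
    if "3 * (a1 + a3 + a2 + a4 + C) = B" for a1 a2 a3 a4 B C :: real using that unfolding distrib_left by linarith
  show ?thesis
  proof
    show "g p = f p" if "p \<in> V0 square" for p using that gx by (auto simp: V0_def x_def)
    have "(\<Sum>i\<in>{1..5}. mode_energy H K (g \<circ> sim square i)) =
      mode_energy H K (g \<circ> sim square 1) + mode_energy H K (g \<circ> sim square 2) + mode_energy H K (g \<circ> sim square 3)
      + mode_energy H K (g \<circ> sim square 4) + mode_energy H K (g \<circ> sim square 5)"
      by (rule sum_1_5)
    then show "(\<Sum>i\<in>{1..5}. mode_energy H (1 / H) (g \<circ> sim square i)) = 1 / 3 * mode_energy H (1 / H) f"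
      using combine[OF id] unfolding K_def[symmetric] cells c b by metis
  qed
qed

lemma mode_energy_le_cells:
  assumes "H > 0"
  shows "mode_energy H (1 / H) g \<le> 3 * (\<Sum>i\<in>{1..5}. mode_energy H (1 / H) (g \<circ> sim square i))"
proof -
  have "0 \<le> 96 * (\<Sum>i\<in>{1..4}. (mode3 (g \<circ> sim square i))\<^sup>2)
      + 16 * (mode3 g - 3 * mode3 (g \<circ> sim square 5))\<^sup>2"
    by (intro add_nonneg_nonneg mult_nonneg_nonneg sum_nonneg) auto
  then show ?thesis using mode_energy_gap[OF assms, of g] by linarith
qed

section \<open>Eigenforms and their eigenvalues\<close>

lemma is_eigenform_vicsek:
  assumes H: "H > 0"
  shows "is_eigenform (vicsek_cond H) (1 / 3)"
  unfolding is_eigenform_def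
proof (intro conjI allI)
  show "is_conductance (vicsek_cond H)" using is_conductance_vicsek[OF H] .
  fix f :: "real ^ 2 \<Rightarrow> real"
  let ?E = "mode_energy H (1 / H)"
  obtain g where g: "\<And>p. p \<in> V0 square \<Longrightarrow> g p = f p" "(\<Sum>i\<in>{1..5}. ?E (g \<circ> sim square i)) = 1 / 3 * ?E f"
    using harmonic_extension[OF H] by metis
  show "Inf {energy_level 1 (vicsek_cond H) g |g. \<forall>p\<in>V0 square. g p = f p} = 1 / 3 * quad_form (vicsek_cond H) f"
    unfolding energy_level_1 quad_form_vicsek
  proof (rule cInf_eq_minimum)
    show "1 / 3 * ?E f \<in> {\<Sum>i\<in>{1..5}. ?E (g \<circ> sim square i) |g. \<forall>p\<in>V0 square. g p = f p}"
      using g by (intro CollectI exI[of _ g]) auto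
    fix t assume "t \<in> {\<Sum>i\<in>{1..5}. ?E (g \<circ> sim square i) |g. \<forall>p\<in>V0 square. g p = f p}"
    then obtain h where h: "\<And>p. p \<in> V0 square \<Longrightarrow> h p = f p" "t = (\<Sum>i\<in>{1..5}. ?E (h \<circ> sim square i))" by auto
    have "?E h = ?E f" using h(1) by (simp add: mode_energy_def mode1_def mode2_def mode3_def V0_eq)
    then show "1 / 3 * ?E f \<le> t" using mode_energy_le_cells[OF H, of h] h(2) by simp
  qed
qed

text \<open>Cells 1, 5 and 3 form a chain along the diagonal. Each bounds the square of its own
  increment, and the sum of three squares is at least a third of the square of the sum. The bound
  yields the positivity of the eigenvalue.\<close>

lemma energy_level_1_ge_diagonal:
  assumes c: "is_conductance c"
  shows "energy_level 1 c g \<ge> 2 / 3 * c (pt square 1) (pt square 3) * (g (pt square 1) - g (pt square 3))\<^sup>2"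
proof -
  define k where "k = c (pt square 1) (pt square 3)"
  define x1 x3 y1 y3 where "x1 = g (pt square 1)" and "x3 = g (pt square 3)"
    and "y1 = g (sim square 5 (pt square 1))" and "y3 = g (sim square 5 (pt square 3))"
  have "(pt square 1, pt square 3) \<in> E0 square"
    by (simp add: E0_def V0_eq pt_eq_iff[OF square_range])
  then have k: "k > 0" using c by (auto simp: is_conductance_def k_def)
  have "quad_form c (g \<circ> sim square 1) \<ge> 2 * k * (x1 - y1)\<^sup>2"
    "quad_form c (g \<circ> sim square 3) \<ge> 2 * k * (y3 - x3)\<^sup>2"
    "quad_form c (g \<circ> sim square 5) \<ge> 2 * k * (y1 - y3)\<^sup>2"
    using quad_form_ge_diagonal[OF c, of "g \<circ> sim square 1"] quad_form_ge_diagonal[OF c, of "g \<circ> sim square 3"]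
      quad_form_ge_diagonal[OF c, of "g \<circ> sim square 5"]
    unfolding comp_def sim_vertex sim_inner_vertex k_def x1_def x3_def y1_def y3_def by auto
  moreover have "quad_form c (g \<circ> sim square 2) \<ge> 0" "quad_form c (g \<circ> sim square 4) \<ge> 0"
    by (rule quad_form_nonneg[OF c])+
  ultimately have "energy_level 1 c g \<ge> 2 * k * (x1 - y1)\<^sup>2 + 2 * k * (y3 - x3)\<^sup>2 + 2 * k * (y1 - y3)\<^sup>2"
    unfolding energy_level_1 sum_1_5 by simp
  moreover have "(x1 - x3)\<^sup>2 / 3 \<le> (x1 - y1)\<^sup>2 + (y3 - x3)\<^sup>2 + (y1 - y3)\<^sup>2"
  proof -
    have "3 * ((x1 - y1)\<^sup>2 + (y3 - x3)\<^sup>2 + (y1 - y3)\<^sup>2) - (x1 - x3)\<^sup>2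
        = ((x1 - y1) - (y1 - y3))\<^sup>2 + ((y1 - y3) - (y3 - x3))\<^sup>2 + ((x1 - y1) - (y3 - x3))\<^sup>2"
      by (simp add: power2_eq_square algebra_simps)
    also have "\<dots> \<ge> 0" by simp
    finally show ?thesis by simp
  qed
  then have "2 * k * ((x1 - x3)\<^sup>2 / 3) \<le> 2 * k * ((x1 - y1)\<^sup>2 + (y3 - x3)\<^sup>2 + (y1 - y3)\<^sup>2)"
    using k by (intro mult_left_mono) auto
  ultimately show ?thesis unfolding k_def[symmetric] x1_def[symmetric] x3_def[symmetric]
    by (simp add: distrib_left)
qed

lemma bdd_below_extension_energies:
  assumes "is_conductance c"
  shows "bdd_below {energy_level 1 c g |g. P g}"
  unfolding energy_level_1 using quad_form_nonneg[OF assms]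
  by (intro bdd_belowI[of _ 0]) (auto intro: sum_nonneg)

lemma eigenform_le_energy_level:
  assumes "is_eigenform c \<rho>"
  shows "\<rho> * quad_form c g \<le> energy_level 1 c g"
proof -
  have c: "is_conductance c" using assms by (simp add: is_eigenform_def)
  have "\<rho> * quad_form c g = Inf {energy_level 1 c h |h. \<forall>p\<in>V0 square. h p = g p}"
    using assms by (simp add: is_eigenform_def)
  also have "\<dots> \<le> energy_level 1 c g"
    by (rule cInf_lower[OF _ bdd_below_extension_energies[OF c]]) auto
  finally show ?thesis .
qed

text \<open>The cells containing the vertices 1 and 3 and the central cell are connected in series, so the effective
  resistance between these vertices triples; this pins down the eigenvalue without Metz's classification.\<close>

lemma eigenvalue_bounds:
  assumes e: "is_eigenform c \<rho>"
  shows "0 < \<rho>" "\<rho> \<le> 1 / 3"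
proof -
  have c: "is_conductance c" using e by (simp add: is_eigenform_def)
  define k where "k = c (pt square 1) (pt square 3)"
  have "(pt square 1, pt square 3) \<in> E0 square"
    by (simp add: E0_def V0_eq pt_eq_iff[OF square_range])
  then have k: "k > 0" using c by (auto simp: is_conductance_def k_def)
  \<comment> \<open>Any function with distinct values at vertices 1 and 3 would do: its extensions
    have energies bounded away from 0.\<close>
  define f where "f p = (if p = pt square 1 then 1 else 0 :: real)" for p
  have f: "f (pt square 1) = 1" "f (pt square 3) = 0" by (auto simp: f_def pt_eq_iff[OF square_range])
  have "2 / 3 * k \<le> Inf {energy_level 1 c g |g. \<forall>p\<in>V0 square. g p = f p}"
  proof (rule cInf_greatest)
    fix t assume "t \<in> {energy_level 1 c g |g. \<forall>p\<in>V0 square. g p = f p}"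
    then obtain g where g: "t = energy_level 1 c g" "\<And>p. p \<in> V0 square \<Longrightarrow> g p = f p" by auto
    have "g (pt square 1) = 1" "g (pt square 3) = 0" using g(2) f by (auto simp: V0_eq)
    then show "2 / 3 * k \<le> t" using energy_level_1_ge_diagonal[OF c, of g] g(1) by (simp add: k_def)
  qed auto
  then have "2 / 3 * k \<le> \<rho> * quad_form c f" using e by (simp add: is_eigenform_def)
  with k have "\<rho> * quad_form c f > 0" by linarith
  then show "\<rho> > 0" using quad_form_nonneg[OF c, of f] by (auto simp: zero_less_mult_iff)
  \<comment> \<open>The infimum of \<open>S\<close> is the effective conductance between vertices 1
    and 3. It is positive, and showing that 3 \<rho> times it is still a lower bound of
    \<open>S\<close> forces 3 \<rho> to be at most 1.\<close>
  define S where "S = {quad_form c h |h. h (pt square 1) = 1 \<and> h (pt square 3) = 0}"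
  have S0: "S \<noteq> {}" using f unfolding S_def by blast
  have Sk: "2 * k \<le> t" if "t \<in> S" for t
  proof -
    obtain h where "t = quad_form c h \<and> h (pt square 1) = 1 \<and> h (pt square 3) = 0"
      using \<open>t \<in> S\<close> unfolding S_def by blast
    then show ?thesis using quad_form_ge_diagonal[OF c, of h] by (simp add: k_def)
  qed
  then have Sb: "bdd_below S" by (rule bdd_belowI)
  have "3 * \<rho> * Inf S \<le> t" if "t \<in> S" for t
  proof -
    obtain h where "t = quad_form c h \<and> h (pt square 1) = 1 \<and> h (pt square 3) = 0"
      using \<open>t \<in> S\<close> unfolding S_def by blast
    then have h: "t = quad_form c h" "h (pt square 1) = 1" "h (pt square 3) = 0" by auto
    \<comment> \<open>Copies of \<open>h\<close> scaled by 1/3 are stacked in cells 3, 5 and 1, with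
      offsets 0, 1/3 and 2/3; cells 2 and 4 are constant, matching the central cell. The total
      energy is 3 * (1/9) = 1/3 of that of \<open>h\<close>, and the boundary values 1 and 0 are
      reproduced, so the new function competes in \<open>S\<close> again.\<close>
    define b where "b i = (if i = 1 then 2 / 3 else if i = 3 then 0 else 1 / 3 + h (pt square i) / 3)" for i :: nat
    define s where "s i = (if i = 1 \<or> i = 3 then 1 / 3 else 0 :: real)" for i :: nat
    obtain g where g: "\<And>i j. i \<in> {1..4} \<Longrightarrow> j \<in> {1..4} \<Longrightarrow>
        g (sim square i (pt square j)) = b i + s i * h (pt square j)"
      using glue_corner_cells[of "\<lambda>i j. b i + s i * h (pt square j)"] by blast
    have corner: "quad_form c (g \<circ> sim square i) = (s i)\<^sup>2 * quad_form c h" if "i \<in> {1..4}" for i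
      by (rule quad_form_affine[where a = "b i"]) (use g that in auto)
    have "g (sim square 5 (pt square j)) = 1 / 3 + 1 / 3 * h (pt square j)" if "j \<in> {1..4}" for j
      using that g[of 1 3] g[of 2 4] g[of 3 1] g[of 4 2] h(2,3) unfolding sim_inner_vertex atLeastAtMost_1_4
      by (elim insertE emptyE) (simp_all add: b_def s_def)
    then have centre: "quad_form c (g \<circ> sim square 5) = (1 / 3)\<^sup>2 * quad_form c h"
      by (intro quad_form_affine[where a = "1 / 3"]) auto
    have "energy_level 1 c g = t / 3"
      unfolding energy_level_1 sum_1_5 h(1)
      by (simp add: corner[of 1, simplified] corner[of 2] corner[of 3] corner[of 4] centre s_def power2_eq_square)
    then have "\<rho> * quad_form c g \<le> t / 3" using eigenform_le_energy_level[OF e, of g] by simp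
    moreover have "g (pt square 1) = 1" "g (pt square 3) = 0"
      using g[of 1 1] g[of 3 3] h by (auto simp: sim_vertex b_def s_def)
    then have "quad_form c g \<in> S" by (auto simp: S_def)
    then have "Inf S \<le> quad_form c g" using Sb by (rule cInf_lower)
    then have "\<rho> * Inf S \<le> \<rho> * quad_form c g" using \<open>\<rho> > 0\<close> by simp
    ultimately show ?thesis by simp
  qed
  then have "3 * \<rho> * Inf S \<le> Inf S" using S0 by (intro cInf_greatest)
  moreover have "2 * k \<le> Inf S" using S0 Sk by (intro cInf_greatest)
  then have "Inf S > 0" using k by linarith
  ultimately show "\<rho> \<le> 1 / 3" by simp
qed

section \<open>Functions of finite energy\<close>

text \<open>\<open>lim\<close> has its intended meaning only once convergence is known; monotonicity
  identifies it with the supremum, which bounds every term.\<close>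

lemma lim_ennreal_incseq:
  assumes "incseq X"
  shows "(\<lambda>n. ennreal (X n)) \<longlonglongrightarrow> lim (\<lambda>n. ennreal (X n))"
    and "ennreal (X m) \<le> lim (\<lambda>n. ennreal (X n))"
proof -
  have inc: "incseq (\<lambda>n. ennreal (X n))"
    using assms by (auto simp: incseq_def intro: ennreal_leI)
  have "(\<lambda>n. ennreal (X n)) \<longlonglongrightarrow> (SUP n. ennreal (X n))" by (rule LIMSEQ_SUP[OF inc])
  moreover from this have "lim (\<lambda>n. ennreal (X n)) = (SUP n. ennreal (X n))" by (rule limI)
  ultimately show "(\<lambda>n. ennreal (X n)) \<longlonglongrightarrow> lim (\<lambda>n. ennreal (X n))"
    "ennreal (X m) \<le> lim (\<lambda>n. ennreal (X n))" by (auto intro: SUP_upper)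
qed

lemma energy_level_Suc:
  "energy_level (Suc n) c f = (\<Sum>\<sigma>\<in>words n. energy_level 1 c (f \<circ> sim_word square \<sigma>))"
  unfolding energy_level_1 by (simp add: energy_level_def sum_words_Suc sim_word_snoc comp_assoc)

text \<open>The restriction of \<open>f\<close> to the next level is one admissible extension in
  each cell, so its energy is at least the infimum defining the eigenvalue.\<close>

lemma incseq_energy_level:
  assumes e: "is_eigenform c \<rho>"
  shows "incseq (\<lambda>n. (1 / \<rho>) ^ n * energy_level n c f)"
proof (rule incseq_SucI)
  fix n
  have \<rho>: "\<rho> > 0" using eigenvalue_bounds[OF e] by simp
  have "\<rho> * energy_level n c f = (\<Sum>\<sigma>\<in>words n. \<rho> * quad_form c (f \<circ> sim_word square \<sigma>))"
    by (simp add: energy_level_def sum_distrib_left)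
  also have "\<dots> \<le> energy_level (Suc n) c f"
    unfolding energy_level_Suc by (intro sum_mono eigenform_le_energy_level[OF e])
  finally have "\<rho> * energy_level n c f \<le> energy_level (Suc n) c f" .
  then have "(1 / \<rho>) ^ Suc n * (\<rho> * energy_level n c f) \<le> (1 / \<rho>) ^ Suc n * energy_level (Suc n) c f"
    using \<rho> by (intro mult_left_mono) auto
  then show "(1 / \<rho>) ^ n * energy_level n c f \<le> (1 / \<rho>) ^ Suc n * energy_level (Suc n) c f"
    using \<rho> by simp
qed

lemma level_sum_eq_energy_level: "level_sum n (quad_form c) f = 3 ^ n * energy_level n c f"
  by (simp add: level_sum_def energy_level_def)

text \<open>The eigenform witnessing finite energy is arbitrary. Since its eigenvalue is at most
  1/3, renormalising by 3^n instead of \<rho>^(-n) keeps the level energies bounded, and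
  comparability carries the bound over to \<open>d\<close>.\<close>

lemma finite_energy_bounded:
  assumes "finite_energy f" and d: "is_conductance d"
  obtains B where "\<And>n. level_sum n (quad_form d) f \<le> B"
proof -
  obtain c \<rho> where e: "is_eigenform c \<rho>" and fin: "self_similar_energy c \<rho> f < \<infinity>"
    using assms(1) by (auto simp: finite_energy_def)
  have c: "is_conductance c" using e by (simp add: is_eigenform_def)
  have \<rho>: "0 < \<rho>" "\<rho> \<le> 1 / 3" using eigenvalue_bounds[OF e] by auto
  define M where "M = enn2real (self_similar_energy c \<rho> f)"
  have M: "(1 / \<rho>) ^ n * energy_level n c f \<le> M" for n
  proof -
    have "ennreal ((1 / \<rho>) ^ n * energy_level n c f) \<le> ennreal M"
      using lim_ennreal_incseq(2)[OF incseq_energy_level[OF e]] fin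
      by (simp add: M_def self_similar_energy_def)
    then show ?thesis by (simp add: M_def ennreal_le_iff)
  qed
  have cB: "level_sum n (quad_form c) f \<le> M" for n
  proof -
    have "energy_level n c f \<ge> 0"
      unfolding energy_level_def by (intro sum_nonneg quad_form_nonneg[OF c])
    moreover have "(3::real) ^ n \<le> (1 / \<rho>) ^ n"
      using \<rho> by (intro power_mono) (auto simp: field_simps)
    ultimately have "3 ^ n * energy_level n c f \<le> (1 / \<rho>) ^ n * energy_level n c f"
      by (intro mult_right_mono)
    then show ?thesis using M[of n] by (simp add: level_sum_eq_energy_level)
  qed
  obtain K where K: "K \<ge> 0" "\<And>g. quad_form d g \<le> K * quad_form c g"
    using quad_form_comparable[OF c d] by metis
  have "level_sum n (quad_form d) f \<le> K * M" for n
  proof -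
    have "level_sum n (quad_form d) f \<le> level_sum n (\<lambda>g. K * quad_form c g) f"
      by (rule level_sum_mono[OF K(2)])
    also have "\<dots> \<le> K * M" unfolding level_sum_cmult using K(1) cB by (intro mult_left_mono)
    finally show ?thesis .
  qed
  then show ?thesis using that by blast
qed

section \<open>Decay of the alternating mode and convergence of the diagonal modes\<close>

lemma mode_energy_increasing:
  assumes "H > 0"
  shows "level_sum n (mode_energy H (1 / H)) f \<le> level_sum (Suc n) (mode_energy H (1 / H)) f"
  unfolding level_sum_Suc by (intro level_sum_mono mode_energy_le_cells assms)

text \<open>The corner cells are paid for by the energy increment in \<open>mode_energy_gap\<close>.
  For the central cell, with alternating modes s outside and t inside, (2 s - 3 t)^2 >= 0 bounds 3
  t^2 by 2/3 s^2 plus 2/3 (s - 3 t)^2, and the last term is again part of the increment.\<close>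

lemma mode3_recursion:
  assumes H: "H > 0"
  shows "level_sum (Suc n) (\<lambda>g. (mode3 g)\<^sup>2) f \<le> 2 / 3 * level_sum n (\<lambda>g. (mode3 g)\<^sup>2) f
    + 1 / 16 * (level_sum (Suc n) (mode_energy H (1 / H)) f - level_sum n (mode_energy H (1 / H)) f)"
proof -
  let ?E = "mode_energy H (1 / H)"
  have "3 * (\<Sum>i\<in>{1..5}. (mode3 (g \<circ> sim square i))\<^sup>2) + 1 / 16 * ?E g
      \<le> 2 / 3 * (mode3 g)\<^sup>2 + 1 / 16 * (3 * (\<Sum>i\<in>{1..5}. ?E (g \<circ> sim square i)))" for g
  proof -
    define s t where "s = mode3 g" and "t = mode3 (g \<circ> sim square 5)"
    define m where "m = (\<Sum>i\<in>{1..4}. (mode3 (g \<circ> sim square i))\<^sup>2)"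
    have "(\<Sum>i\<in>{1..5}. (mode3 (g \<circ> sim square i))\<^sup>2) = m + t\<^sup>2"
      unfolding m_def t_def sum_1_5 sum_1_4 by simp
    moreover have "?E g + 96 * m + 16 * (s - 3 * t)\<^sup>2 \<le> 3 * (\<Sum>i\<in>{1..5}. ?E (g \<circ> sim square i))"
      using mode_energy_gap[OF H, of g] by (simp add: s_def t_def m_def)
    moreover have "3 * t\<^sup>2 \<le> 2 / 3 * s\<^sup>2 + 2 / 3 * (s - 3 * t)\<^sup>2"
    proof -
      have "2 / 3 * s\<^sup>2 + 2 / 3 * (s - 3 * t)\<^sup>2 - 3 * t\<^sup>2 = (2 * s - 3 * t)\<^sup>2 / 3"
        by (simp add: power2_eq_square field_simps)
      also have "\<dots> \<ge> 0" by simp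
      finally show ?thesis by simp
    qed
    moreover have "m \<ge> 0" "(s - 3 * t)\<^sup>2 \<ge> 0" by (auto simp: m_def intro: sum_nonneg)
    ultimately show ?thesis unfolding s_def[symmetric] by linarith
  qed
  then have "level_sum n (\<lambda>g. 3 * (\<Sum>i\<in>{1..5}. (mode3 (g \<circ> sim square i))\<^sup>2) + 1 / 16 * ?E g) f
      \<le> level_sum n (\<lambda>g. 2 / 3 * (mode3 g)\<^sup>2 + 1 / 16 * (3 * (\<Sum>i\<in>{1..5}. ?E (g \<circ> sim square i)))) f"
    by (rule level_sum_mono)
  then show ?thesis
    unfolding level_sum_add level_sum_cmult[of _ "1 / 16"] level_sum_cmult[of _ "2 / 3"] level_sum_Suc right_diff_distrib
    by (simp only: add_diff_eq le_diff_eq)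
qed

lemma finite_energy_modes:
  assumes "finite_energy f"
  obtains P Q where "(\<lambda>n. level_sum n (\<lambda>g. (mode1 g)\<^sup>2) f) \<longlonglongrightarrow> P"
    "(\<lambda>n. level_sum n (\<lambda>g. (mode2 g)\<^sup>2) f) \<longlonglongrightarrow> Q" "(\<lambda>n. level_sum n (\<lambda>g. (mode3 g)\<^sup>2) f) \<longlonglongrightarrow> 0"
proof -
  define p q r where "p n = level_sum n (\<lambda>g. (mode1 g)\<^sup>2) f" and "q n = level_sum n (\<lambda>g. (mode2 g)\<^sup>2) f"
    and "r n = level_sum n (\<lambda>g. (mode3 g)\<^sup>2) f" for n
  define E where "E H n = level_sum n (mode_energy H (1 / H)) f" for H n
  have bd: "\<exists>B. \<forall>n. E H n \<le> B" if H: "H > 0" for H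
    using finite_energy_bounded[OF assms is_conductance_vicsek[OF H]]
    unfolding E_def quad_form_vicsek[abs_def] by metis
  have conv: "convergent (E H)" if H: "H > 0" for H
  proof (rule Bseq_mono_convergent)
    have inc: "incseq (E H)" unfolding E_def by (rule incseq_SucI) (rule mode_energy_increasing[OF H])
    then show "\<forall>m n. m \<le> n \<longrightarrow> E H m \<le> E H n" by (auto simp: incseq_def)
    obtain B where B: "\<And>n. E H n \<le> B" using bd[OF H] by auto
    show "Bseq (E H)"
    proof (rule BseqI'[where K = "\<bar>B\<bar> + \<bar>E H 0\<bar>"])
      show "norm (E H n) \<le> \<bar>B\<bar> + \<bar>E H 0\<bar>" for n
        using B[of n] incseqD[OF inc, of 0 n] by auto
    qed
  qed
  obtain L1 L2 where L1: "E 1 \<longlonglongrightarrow> L1" and L2: "E 2 \<longlonglongrightarrow> L2"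
    using conv[of 1] conv[of 2] by (auto simp: convergent_def)
  have r0: "r n \<ge> 0" for n unfolding r_def by (rule level_sum_nonneg) simp
  have "r \<longlonglongrightarrow> 0"
  proof -
    \<comment> \<open>Subtracting the energy turns the recursion into v (n + 1) <= v n - r n / 3. So
      \<open>v\<close> decreases, it is bounded below because the energy is bounded above, and its
      vanishing differences squeeze \<open>r\<close> to 0.\<close>
    define v where "v n = r n - 1 / 16 * E 1 n" for n
    have v: "r n \<le> 3 * (v n - v (Suc n))" for n
    proof -
      have "r (Suc n) \<le> 2 / 3 * r n + 1 / 16 * (E 1 (Suc n) - E 1 n)"
        unfolding r_def E_def by (rule mode3_recursion) simp
      then show ?thesis unfolding v_def right_diff_distrib by linarith
    qed
    have dec: "decseq v" using v r0 by (intro decseq_SucI) (smt (verit))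
    obtain B where B: "\<And>n. E 1 n \<le> B" using bd[of 1] by auto
    have "v n \<ge> - (1 / 16 * B)" for n using r0[of n] B[of n] by (simp add: v_def)
    then obtain l where l: "v \<longlonglongrightarrow> l" using decseq_convergent[OF dec] by metis
    have "(\<lambda>n. 3 * (v n - v (Suc n))) \<longlonglongrightarrow> 3 * (l - l)"
      by (intro tendsto_intros l LIMSEQ_Suc[OF l])
    then have "(\<lambda>n. 3 * (v n - v (Suc n))) \<longlonglongrightarrow> 0" by simp
    then show ?thesis
      by (rule tendsto_sandwich[OF _ _ tendsto_const, rotated 2]) (use r0 v in auto)
  qed
  moreover have E: "E H n = 2 * (4 * (1 + H) * p n + 4 * (1 + 1 / H) * q n + 16 * r n)" for H n
    unfolding E_def p_def q_def r_def by (rule level_sum_mode_energy)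
  \<comment> \<open>The weights of the two diagonal modes are proportional to (2, 2) for H = 1 and
    to (3, 3/2) for H = 2, hence independent. The two energies together with \<open>r\<close>
    therefore determine \<open>p\<close> and \<open>q\<close>.\<close>
  have "p n = (E 2 n / 2 - 16 * r n) / 6 - (E 1 n / 2 - 16 * r n) / 8" for n
    unfolding E by (simp add: field_simps)
  then have "p = (\<lambda>n. (E 2 n / 2 - 16 * r n) / 6 - (E 1 n / 2 - 16 * r n) / 8)" by auto
  moreover have "q n = (E 1 n / 2 - 16 * r n) / 4 - (E 2 n / 2 - 16 * r n) / 6" for n
    unfolding E by (simp add: field_simps)
  then have "q = (\<lambda>n. (E 1 n / 2 - 16 * r n) / 4 - (E 2 n / 2 - 16 * r n) / 6)" by auto
  moreover have "(\<lambda>n. (E 2 n / 2 - 16 * r n) / 6 - (E 1 n / 2 - 16 * r n) / 8) \<longlonglongrightarrow> (L2 / 2 - 16 * 0) / 6 - (L1 / 2 - 16 * 0) / 8"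
    "(\<lambda>n. (E 1 n / 2 - 16 * r n) / 4 - (E 2 n / 2 - 16 * r n) / 6) \<longlonglongrightarrow> (L1 / 2 - 16 * 0) / 4 - (L2 / 2 - 16 * 0) / 6"
    if "r \<longlonglongrightarrow> 0" by (intro tendsto_intros L1 L2 that; simp)+
  ultimately have "p \<longlonglongrightarrow> (L2 / 2 - 16 * 0) / 6 - (L1 / 2 - 16 * 0) / 8"
    "q \<longlonglongrightarrow> (L1 / 2 - 16 * 0) / 4 - (L2 / 2 - 16 * 0) / 6" "r \<longlonglongrightarrow> 0"
    by simp_all
  then show ?thesis using that unfolding p_def q_def r_def by blast
qed

lemma self_similar_energy_vicsek:
  assumes "(\<lambda>n. level_sum n (\<lambda>g. (mode1 g)\<^sup>2) f) \<longlonglongrightarrow> P"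
    "(\<lambda>n. level_sum n (\<lambda>g. (mode2 g)\<^sup>2) f) \<longlonglongrightarrow> Q" "(\<lambda>n. level_sum n (\<lambda>g. (mode3 g)\<^sup>2) f) \<longlonglongrightarrow> 0"
  shows "self_similar_energy (vicsek_cond H) (1 / 3) f = ennreal (8 * ((1 + H) * P + (1 + 1 / H) * Q))"
proof -
  have *: "2 * (4 * a * P + 4 * b * Q + 16 * 0) = 8 * (a * P + b * Q)" for a b :: real
    by (simp add: algebra_simps)
  have "(\<lambda>n. 2 * (4 * (1 + H) * level_sum n (\<lambda>g. (mode1 g)\<^sup>2) f + 4 * (1 + 1 / H) * level_sum n (\<lambda>g. (mode2 g)\<^sup>2) f
      + 16 * level_sum n (\<lambda>g. (mode3 g)\<^sup>2) f)) \<longlonglongrightarrow> 2 * (4 * (1 + H) * P + 4 * (1 + 1 / H) * Q + 16 * 0)"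
    by (intro tendsto_intros assms)
  also have "2 * (4 * (1 + H) * P + 4 * (1 + 1 / H) * Q + 16 * 0) = 8 * ((1 + H) * P + (1 + 1 / H) * Q)"
    by (rule *)
  finally have "(\<lambda>n. level_sum n (quad_form (vicsek_cond H)) f) \<longlonglongrightarrow> 8 * ((1 + H) * P + (1 + 1 / H) * Q)"
    unfolding quad_form_vicsek[abs_def] level_sum_mode_energy .
  then show ?thesis
    unfolding self_similar_energy_def level_sum_eq_energy_level
    by (intro limI) (simp add: tendsto_ennrealI)
qed

section \<open>The zeta function\<close>

lemma to_rhombus_pt: "to_rhombus \<theta> (pt square i) = pt \<theta> i"
proof -
  have "cos square \<noteq> 0" "sin square \<noteq> 0" by (simp_all add: cos_45 sin_45)
  then show ?thesis by (simp add: to_rhombus_def pt_def vec_eq_iff forall_2 del: cos_45 sin_45)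
qed

lemma to_rhombus_sim: "to_rhombus \<theta> (sim square i x) = sim \<theta> i (to_rhombus \<theta> x)"
proof -
  have "to_rhombus \<theta> (p + (1 / 3) *\<^sub>R (x - p)) = to_rhombus \<theta> p + (1 / 3) *\<^sub>R (to_rhombus \<theta> x - to_rhombus \<theta> p)" for p
    by (simp add: to_rhombus_def vec_eq_iff forall_2 diff_divide_distrib add_divide_distrib distrib_left right_diff_distrib)
  then show ?thesis by (simp add: sim_def to_rhombus_pt)
qed

lemma to_rhombus_sim_word: "to_rhombus \<theta> (sim_word square \<sigma> x) = sim_word \<theta> \<sigma> (to_rhombus \<theta> x)"
  by (induction \<sigma>) (auto simp: sim_word_def to_rhombus_sim)

lemma edge_length_pos:
  assumes "e \<in> E0 \<theta>"
  shows "edge_length e > 0"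
  using assms by (auto simp: E0_def edge_length_def)

lemma norm_real2: "norm (x :: real ^ 2) = sqrt ((x $ 1)\<^sup>2 + (x $ 2)\<^sup>2)"
  by (simp add: norm_vec_def L2_set_def UNIV_2)

text \<open>The sides have length 1, so they keep conductance 1 for every exponent; only the two
  diagonals feel it. This is why the family (1,1,1,1,u,v) suffices for all s.\<close>

lemma edge_energy:
  assumes \<theta>: "0 < \<theta>" "\<theta> < pi / 2"
  shows "(\<Sum>e\<in>E0 \<theta>. edge_length e powr a * (f (sim_word \<theta> \<sigma> (fst e)) - f (sim_word \<theta> \<sigma> (snd e)))\<^sup>2)
    = mode_energy ((2 * cos \<theta>) powr a) ((2 * sin \<theta>) powr a) (f \<circ> to_rhombus \<theta> \<circ> sim_word square \<sigma>)"
proof -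
  have pos: "cos \<theta> > 0" "sin \<theta> > 0" using \<theta> by (auto intro: cos_gt_zero sin_gt_zero2)
  define d where "d i j = norm (pt \<theta> i - pt \<theta> j)" for i j
  have dij: "d 1 2 = 1" "d 2 1 = 1" "d 2 3 = 1" "d 3 2 = 1" "d 3 4 = 1" "d 4 3 = 1" "d 4 1 = 1" "d 1 4 = 1"
    "d 1 3 = 2 * cos \<theta>" "d 3 1 = 2 * cos \<theta>" "d 2 4 = 2 * sin \<theta>" "d 4 2 = 2 * sin \<theta>"
  proof -
    have "sqrt (4 * a\<^sup>2) = 2 * a" if "a > 0" for a :: real
      using that by (simp add: real_sqrt_mult)
    with pos show "d 1 2 = 1" "d 2 1 = 1" "d 2 3 = 1" "d 3 2 = 1" "d 3 4 = 1" "d 4 3 = 1" "d 4 1 = 1" "d 1 4 = 1"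
      "d 1 3 = 2 * cos \<theta>" "d 3 1 = 2 * cos \<theta>" "d 2 4 = 2 * sin \<theta>" "d 4 2 = 2 * sin \<theta>"
      by (simp_all add: d_def norm_real2 pt_simps)
  qed
  define g where "g = f \<circ> to_rhombus \<theta> \<circ> sim_word square \<sigma>"
  have g: "f (sim_word \<theta> \<sigma> (pt \<theta> i)) = g (pt square i)" for i
    by (simp add: g_def to_rhombus_sim_word to_rhombus_pt)
  have "(\<Sum>e\<in>E0 \<theta>. edge_length e powr a * (f (sim_word \<theta> \<sigma> (fst e)) - f (sim_word \<theta> \<sigma> (snd e)))\<^sup>2)
    = (\<Sum>(p, q)\<in>E0 \<theta>. norm (p - q) powr a * (f (sim_word \<theta> \<sigma> p) - f (sim_word \<theta> \<sigma> q))\<^sup>2)"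
    by (simp add: edge_length_def case_prod_unfold)
  also have "\<dots> = mode_energy ((2 * cos \<theta>) powr a) ((2 * sin \<theta>) powr a) g"
    unfolding sum_E0[OF \<theta>] g d_def[symmetric] dij mode_energy_vertices
    by (simp add: power2_eq_square algebra_simps)
  finally show ?thesis by (simp add: g_def)
qed

text \<open>The eigenvalues multiply to (3^n / l)^(2 - s) \<Delta>^2, with l the edge length and
  \<Delta> the difference of \<open>f\<close>. Splitting 3^(n (2 - s)) as 3^(n (1 - s)) * 3^n
  separates the Abel variable from the renormalisation built into \<open>level_sum\<close>.\<close>

lemma zeta_term:
  fixes f :: "real ^ 2 \<Rightarrow> real"
  assumes e: "e \<in> E0 \<theta>" and n: "n = length \<sigma>"
    and T: "T = abs_op (dirac_commutator \<theta> (\<lambda>x. complex_of_real (f x)))"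
  shows "Re (ip (basis_vec (\<sigma>, e)) ((T \<circ> T \<circ> abs_op_power dirac (- s)) (basis_vec (\<sigma>, e))))
    = (3 powr (1 - s)) ^ n * (3 ^ n * (edge_length e powr (s - 2) *
        (f (sim_word \<theta> \<sigma> (fst e)) - f (sim_word \<theta> \<sigma> (snd e)))\<^sup>2))"
proof -
  define l where "l = edge_length e"
  define \<Delta> where "\<Delta> = f (sim_word \<theta> \<sigma> (fst e)) - f (sim_word \<theta> \<sigma> (snd e))"
  have l: "l > 0" using edge_length_pos[OF e] by (simp add: l_def)
  have diag: "diag_op a (\<lambda>j. b * basis_vec k j) = (\<lambda>j. (of_real (a k) * b) * basis_vec k j)" for a b k
    by (rule ext) (simp add: diag_op_def basis_vec_def)
  have cm: "sqrt (Re (cnj z * z)) = cmod z" for z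
    by (simp add: cmod_def power2_eq_square)
  have ev1: "abs_eigenvalue dirac (\<sigma>, e) = 3 ^ n / l"
  proof -
    have "abs_eigenvalue dirac (\<sigma>, e) = cmod (of_real (3 ^ n / l))"
      unfolding abs_eigenvalue_def dirac_basis ip_scaled_basis by (simp only: cm n l_def if_True simp_thms)
    also have "\<dots> = 3 ^ n / l" using l by (simp only: norm_of_real) simp
    finally show ?thesis .
  qed
  have ev2: "abs_eigenvalue (dirac_commutator \<theta> (\<lambda>x. complex_of_real (f x))) (\<sigma>, e) = 3 ^ n / l * \<bar>\<Delta>\<bar>"
  proof -
    have "abs_eigenvalue (dirac_commutator \<theta> (\<lambda>x. complex_of_real (f x))) (\<sigma>, e)
        = cmod (of_real (3 ^ n / l) * (of_real (f (sim_word \<theta> \<sigma> (fst e))) - of_real (f (sim_word \<theta> \<sigma> (snd e)))))"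
      unfolding abs_eigenvalue_def dirac_commutator_basis ip_scaled_basis by (simp only: cm n l_def if_True simp_thms)
    also have "\<dots> = cmod (of_real (3 ^ n / l * \<Delta>))" by (simp add: \<Delta>_def)
    also have "\<dots> = 3 ^ n / l * \<bar>\<Delta>\<bar>" using l by (simp only: norm_of_real abs_mult) simp
    finally show ?thesis .
  qed
  define w p where "w = 3 ^ n / l * \<bar>\<Delta>\<bar>" and "p = (3 ^ n / l) powr (- s)"
  have diag1: "diag_op a (basis_vec k) = (\<lambda>j. of_real (a k) * basis_vec k j)" for a k
    using diag[of a 1 k] by simp
  have "(T \<circ> T \<circ> abs_op_power dirac (- s)) (basis_vec (\<sigma>, e))
      = (\<lambda>j. (of_real w * (of_real w * of_real p)) * basis_vec (\<sigma>, e) j)"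
    by (simp only: T abs_op_def abs_op_power_def comp_apply diag1 diag ev1 ev2 w_def p_def)
  moreover have "ip (basis_vec k) (\<lambda>j. b * basis_vec k j) = b" for k b
    using ip_scaled_basis[of 1 k b k] by simp
  ultimately have "Re (ip (basis_vec (\<sigma>, e)) ((T \<circ> T \<circ> abs_op_power dirac (- s)) (basis_vec (\<sigma>, e)))) = w * (w * p)"
    by (simp only: of_real_mult[symmetric] Re_complex_of_real)
  also have "\<dots> = ((3 ^ n / l)\<^sup>2 * (3 ^ n / l) powr (- s)) * \<Delta>\<^sup>2"
    unfolding w_def p_def by (simp add: power2_eq_square mult_ac)
  also have "(3 ^ n / l)\<^sup>2 * (3 ^ n / l) powr (- s) = (3 ^ n / l) powr (2 - s)"
    using l by (simp add: powr_diff powr_minus field_simps)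
  also have "\<dots> = (3 ^ n) powr (2 - s) * l powr (s - 2)"
    using l by (simp add: powr_divide powr_diff field_simps)
  also have "(3 ^ n) powr (2 - s) = (3 powr (1 - s)) ^ n * (3 ^ n :: real)"
  proof -
    have "(3 ^ n) powr (2 - s) = (3 powr (2 - s)) ^ n"
      by (simp add: powr_power powr_powr powr_realpow[symmetric] mult.commute)
    also have "(3 :: real) powr (2 - s) = 3 powr (1 - s) * 3"
      using powr_add[of 3 "1 - s" 1] by simp
    finally show ?thesis by (simp only: power_mult_distrib)
  qed
  finally show ?thesis by (simp only: l_def \<Delta>_def mult.assoc)
qed

section \<open>The trace as a series over levels\<close>

lemma has_sum_ennreal:
  fixes t :: "'a \<Rightarrow> real"
  assumes "(t has_sum S) A" "\<And>k. k \<in> A \<Longrightarrow> t k \<ge> 0"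
  shows "((\<lambda>k. ennreal (t k)) has_sum ennreal S) A"
proof -
  have "((ennreal \<circ> t) has_sum ennreal S) A"
  proof (rule has_sum_comm_additive_general)
    show "sum (ennreal \<circ> t) F = ennreal (sum t F)" if "finite F" "F \<subseteq> A" for F
      using that assms(2) by (auto simp: sum_ennreal subset_iff)
    show "ennreal \<midarrow>S\<rightarrow> ennreal S" by (intro tendsto_ennrealI tendsto_ident_at)
  qed (rule assms)
  then show ?thesis by (simp add: comp_def)
qed

text \<open>The index set splits into finite blocks by word length, and nonnegativity turns the
  ordered series of block sums into an unordered sum.\<close>

lemma has_sum_index_set:
  fixes t :: "idx \<Rightarrow> real"
  assumes nonneg: "\<And>k. k \<in> index_set \<theta> \<Longrightarrow> t k \<ge> 0"
    and sums: "(\<lambda>n. \<Sum>\<sigma>\<in>words n. \<Sum>e\<in>E0 \<theta>. t (\<sigma>, e)) sums S"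
  shows "(t has_sum S) (index_set \<theta>)"
proof -
  let ?B = "\<lambda>n. words n \<times> E0 \<theta>"
  let ?b = "\<lambda>n. \<Sum>k\<in>?B n. t k"
  have sub: "?B n \<subseteq> index_set \<theta>" for n by (auto simp: index_set_def)
  have fin: "finite (?B n)" for n using finite_words finite_E0 by auto
  have b: "?b sums S" using sums by (simp add: sum.cartesian_product)
  have t0: "t k \<ge> 0" if "k \<in> ?B n" for k n using nonneg sub that by blast
  have bn: "?b n \<ge> 0" for n by (intro sum_nonneg t0)
  have bS: "(?b has_sum S) UNIV" by (rule sums_nonneg_imp_has_sum[OF b bn])
  have "(\<lambda>x. norm (case x of (n, k) \<Rightarrow> t k)) summable_on (SIGMA n:UNIV. ?B n)"
  proof (rule Infinite_Sum.abs_summable_on_Sigma_iff[THEN iffD2], intro conjI ballI)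
    show "(\<lambda>k. norm (case (n, k) of (n, k) \<Rightarrow> t k)) summable_on ?B n" for n
      using fin by (rule summable_on_finite)
    have "(\<Sum>\<^sub>\<infinity>k\<in>?B n. norm (case (n, k) of (n, k) \<Rightarrow> t k)) = ?b n" for n
      using fin t0[of _ n] by (simp del: mem_Sigma_iff)
    then show "(\<lambda>n. norm (\<Sum>\<^sub>\<infinity>k\<in>?B n. norm (case (n, k) of (n, k) \<Rightarrow> t k))) summable_on UNIV"
      using bS bn by (auto simp: summable_on_def)
  qed
  then have "(\<lambda>(n, k). t k) summable_on (SIGMA n:UNIV. ?B n)" by (rule Infinite_Sum.abs_summable_summable)
  then have "((\<lambda>(n, k). t k) has_sum S) (SIGMA n:UNIV. ?B n)"
    by (intro has_sum_SigmaI[OF _ bS]) (use fin in simp_all)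
  \<comment> \<open>A word determines its length, so forgetting the block number is
    injective.\<close>
  moreover have "bij_betw snd (SIGMA n:UNIV. ?B n) (index_set \<theta>)"
    unfolding bij_betw_def by (auto simp: inj_on_def words_def index_set_def image_iff)
  ultimately show ?thesis
    using has_sum_reindex_bij_betw[of snd "SIGMA n:UNIV. ?B n" "index_set \<theta>" t S]
    by (simp add: case_prod_unfold)
qed

lemma zeta_comm_eq:
  assumes \<theta>: "0 < \<theta>" "\<theta> < pi / 2"
    and sums: "(\<lambda>n. (3 powr (1 - s)) ^ n *
      level_sum n (mode_energy ((2 * cos \<theta>) powr (s - 2)) ((2 * sin \<theta>) powr (s - 2))) (f \<circ> to_rhombus \<theta>)) sums S"
  shows "zeta_comm \<theta> (\<lambda>x. complex_of_real (f x)) s = ennreal S"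
proof -
  define t where "t = (\<lambda>(\<sigma>, e). (3 powr (1 - s)) ^ length \<sigma> * (3 ^ length \<sigma> * (edge_length e powr (s - 2) *
        (f (sim_word \<theta> \<sigma> (fst e)) - f (sim_word \<theta> \<sigma> (snd e)))\<^sup>2)))"
  have "(\<Sum>\<sigma>\<in>words n. \<Sum>e\<in>E0 \<theta>. t (\<sigma>, e)) = (3 powr (1 - s)) ^ n *
      level_sum n (mode_energy ((2 * cos \<theta>) powr (s - 2)) ((2 * sin \<theta>) powr (s - 2))) (f \<circ> to_rhombus \<theta>)" for n
    unfolding level_sum_def edge_energy[OF \<theta>, symmetric] sum_distrib_left
    by (intro sum.cong refl) (auto simp: t_def words_def)
  then have "(t has_sum S) (index_set \<theta>)"
    using sums by (intro has_sum_index_set) (auto simp: t_def)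
  then have "((\<lambda>k. ennreal (t k)) has_sum ennreal S) (index_set \<theta>)"
    by (rule has_sum_ennreal) (auto simp: t_def)
  then have "(\<Sum>\<^sub>\<infinity>k\<in>index_set \<theta>. ennreal (t k)) = ennreal S" by (rule infsumI)
  moreover have "zeta_comm \<theta> (\<lambda>x. complex_of_real (f x)) s = (\<Sum>\<^sub>\<infinity>k\<in>index_set \<theta>. ennreal (t k))"
    unfolding zeta_comm_def op_trace_def
    by (rule infsum_cong) (auto simp: index_set_def t_def zeta_term[OF _ refl refl] simp del: comp_apply)
  ultimately show ?thesis by simp
qed

text \<open>For s > 1 the zeta function combines three Abel sums, and s enters the coefficients only
  through the diagonal conductances. These are continuous at s = 1, so the residue can be taken in
  each sum separately.\<close>

lemma has_residue_zeta_comm: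
  assumes \<theta>: "0 < \<theta>" "\<theta> < pi / 2"
    and P: "(\<lambda>n. level_sum n (\<lambda>g. (mode1 g)\<^sup>2) (f \<circ> to_rhombus \<theta>)) \<longlonglongrightarrow> P"
    and Q: "(\<lambda>n. level_sum n (\<lambda>g. (mode2 g)\<^sup>2) (f \<circ> to_rhombus \<theta>)) \<longlonglongrightarrow> Q"
    and R: "(\<lambda>n. level_sum n (\<lambda>g. (mode3 g)\<^sup>2) (f \<circ> to_rhombus \<theta>)) \<longlonglongrightarrow> 0"
  shows "has_residue_at_1 (zeta_comm \<theta> (\<lambda>x. complex_of_real (f x)))
    (8 * ((1 + 1 / (2 * cos \<theta>)) * P + (1 + 1 / (2 * sin \<theta>)) * Q) / ln 3)"
proof -
  have pos: "cos \<theta> > 0" "sin \<theta> > 0" using \<theta> by (auto intro: cos_gt_zero sin_gt_zero2)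
  define p q r where "p n = level_sum n (\<lambda>g. (mode1 g)\<^sup>2) (f \<circ> to_rhombus \<theta>)"
    and "q n = level_sum n (\<lambda>g. (mode2 g)\<^sup>2) (f \<circ> to_rhombus \<theta>)"
    and "r n = level_sum n (\<lambda>g. (mode3 g)\<^sup>2) (f \<circ> to_rhombus \<theta>)" for n
  note lims = P[folded p_def] Q[folded q_def] R[folded r_def]
  define A where "A b s = (\<Sum>n. b n * (3 powr (1 - s)) ^ n)" for b :: "nat \<Rightarrow> real" and s :: real
  define u v where "u s = (2 * cos \<theta>) powr (s - 2)" and "v s = (2 * sin \<theta>) powr (s - 2)" for s
  have A: "(\<lambda>n. b n * (3 powr (1 - s)) ^ n) sums A b s" if s: "s > 1" and b: "b \<longlonglongrightarrow> L" for b L s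
  proof -
    obtain M where "\<And>n. \<bar>b n\<bar> \<le> M"
      using convergent_imp_Bseq[OF convergentI[OF b]] by (auto simp: Bseq_def)
    then show ?thesis unfolding A_def
      using s by (intro summable_sums summable_bounded_power[where M = M]) (auto simp: powr_less_one)
  qed
  define Z where "Z s = 2 * (4 * (1 + u s) * A p s + 4 * (1 + v s) * A q s + 16 * A r s)" for s
  have zeta: "zeta_comm \<theta> (\<lambda>x. complex_of_real (f x)) s = ennreal (Z s)" if s: "s > 1" for s
  proof (rule zeta_comm_eq[OF \<theta>])
    have "(\<lambda>n. 2 * (4 * (1 + u s) * (p n * (3 powr (1 - s)) ^ n) + 4 * (1 + v s) * (q n * (3 powr (1 - s)) ^ n)
        + 16 * (r n * (3 powr (1 - s)) ^ n))) sums Z s"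
      unfolding Z_def using lims by (intro sums_mult sums_add A[OF s])
    then show "(\<lambda>n. (3 powr (1 - s)) ^ n * level_sum n (mode_energy ((2 * cos \<theta>) powr (s - 2))
        ((2 * sin \<theta>) powr (s - 2))) (f \<circ> to_rhombus \<theta>)) sums Z s"
      unfolding level_sum_mode_energy p_def q_def r_def u_def v_def by (simp add: algebra_simps)
  qed
  have lim: "((\<lambda>s. (s - 1) * A b s) \<longlongrightarrow> L / ln 3) (at_right 1)" if "b \<longlonglongrightarrow> L" for b L
    unfolding A_def using abel_residue[OF that] .
  have uv: "(u \<longlongrightarrow> 1 / (2 * cos \<theta>)) (at_right 1)" "(v \<longlongrightarrow> 1 / (2 * sin \<theta>)) (at_right 1)"
  proof -
    have "((\<lambda>s. c powr (s - 2)) \<longlongrightarrow> c powr (1 - 2)) (at_right 1)" if "c > 0" for c :: real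
      using that by (intro tendsto_intros) auto
    moreover have "c powr (1 - 2) = 1 / c" if "c > 0" for c :: real
      using that powr_minus[of c 1] by (simp add: divide_inverse)
    ultimately show "(u \<longlongrightarrow> 1 / (2 * cos \<theta>)) (at_right 1)" "(v \<longlongrightarrow> 1 / (2 * sin \<theta>)) (at_right 1)"
      unfolding u_def v_def using pos by (metis mult_pos_pos zero_less_numeral)+
  qed
  have "((\<lambda>s. 2 * (4 * (1 + u s) * ((s - 1) * A p s) + 4 * (1 + v s) * ((s - 1) * A q s) + 16 * ((s - 1) * A r s)))
      \<longlongrightarrow> 2 * (4 * (1 + 1 / (2 * cos \<theta>)) * (P / ln 3) + 4 * (1 + 1 / (2 * sin \<theta>)) * (Q / ln 3) + 16 * (0 / ln 3))) (at_right 1)"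
    by (intro tendsto_intros uv lim lims)
  also have "(\<lambda>s. 2 * (4 * (1 + u s) * ((s - 1) * A p s) + 4 * (1 + v s) * ((s - 1) * A q s) + 16 * ((s - 1) * A r s)))
      = (\<lambda>s. (s - 1) * Z s)" by (simp add: Z_def algebra_simps)
  also have "2 * (4 * (1 + 1 / (2 * cos \<theta>)) * (P / ln 3) + 4 * (1 + 1 / (2 * sin \<theta>)) * (Q / ln 3) + 16 * (0 / ln 3))
      = 8 * ((1 + 1 / (2 * cos \<theta>)) * P + (1 + 1 / (2 * sin \<theta>)) * Q) / ln 3"
  proof -
    have "2 * (4 * a * (P / l) + 4 * b * (Q / l) + 16 * (0 / l)) = 8 * (a * P + b * Q) / l" for a b l :: real
      by (simp add: algebra_simps add_divide_distrib)
    then show ?thesis .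
  qed
  finally have "((\<lambda>s. ennreal ((s - 1) * Z s)) \<longlongrightarrow>
      ennreal (8 * ((1 + 1 / (2 * cos \<theta>)) * P + (1 + 1 / (2 * sin \<theta>)) * Q) / ln 3)) (at_right 1)"
    by (rule tendsto_ennrealI)
  moreover have "eventually (\<lambda>s::real. s > 1) (at_right 1)" by (simp add: eventually_at_right_less)
  then have "eventually (\<lambda>s. ennreal ((s - 1) * Z s) =
      ennreal (s - 1) * zeta_comm \<theta> (\<lambda>x. complex_of_real (f x)) s) (at_right 1)"
    by eventually_elim (simp add: zeta ennreal_mult')
  ultimately have "((\<lambda>s. ennreal (s - 1) * zeta_comm \<theta> (\<lambda>x. complex_of_real (f x)) s) \<longlongrightarrow>
      ennreal (8 * ((1 + 1 / (2 * cos \<theta>)) * P + (1 + 1 / (2 * sin \<theta>)) * Q) / ln 3)) (at_right 1)"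
    by (rule Lim_transform_eventually)
  \<comment> \<open>\<open>has_residue_at_1\<close> asks for a nonnegative value; \<open>P\<close>
    and \<open>Q\<close> are limits of nonnegative level sums.\<close>
  moreover have "P \<ge> 0" "Q \<ge> 0"
    using LIMSEQ_le_const[OF P, of 0] LIMSEQ_le_const[OF Q, of 0] level_sum_nonneg by (auto simp: level_sum_nonneg)
  then have "8 * ((1 + 1 / (2 * cos \<theta>)) * P + (1 + 1 / (2 * sin \<theta>)) * Q) / ln 3 \<ge> 0"
    using pos by (intro divide_nonneg_nonneg mult_nonneg_nonneg add_nonneg_nonneg) auto
  ultimately show ?thesis unfolding has_residue_at_1_def by blast
qed

section \<open>The conductance as a function of the angle\<close>

lemma H_of_eq:
  assumes \<theta>: "0 < \<theta>" "\<theta> < pi / 2"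
  shows "H_of \<theta> = (2 + 1 / cos \<theta>) / (2 + 1 / sin \<theta>)"
proof -
  have pos: "cos \<theta> > 0" "sin \<theta> > 0" using \<theta> by (auto intro: cos_gt_zero sin_gt_zero2)
  have "1 + (tan \<theta>)\<^sup>2 = (1 / cos \<theta>)\<^sup>2" "1 + (cot \<theta>)\<^sup>2 = (1 / sin \<theta>)\<^sup>2"
    using pos sin_cos_squared_add[of \<theta>] by (simp_all add: tan_def cot_def field_simps)
  then show ?thesis using pos unfolding H_of_def by (simp only: real_sqrt_abs) simp
qed

lemma H_of_pos:
  assumes "0 < \<theta>" "\<theta> < pi / 2"
  shows "H_of \<theta> > 0"
  unfolding H_of_eq[OF assms] using assms
  by (intro divide_pos_pos add_pos_pos) (auto intro: cos_gt_zero sin_gt_zero2)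

text \<open>As the angle grows, 2 + 1 / cos increases and 2 + 1 / sin decreases.\<close>

lemma H_of_strict_mono:
  assumes "0 < x" "x < y" "y < pi / 2"
  shows "H_of x < H_of y"
proof -
  have c: "cos y < cos x" using assms by (intro cos_monotone_0_pi) auto
  have s: "sin x < sin y" using assms by (intro sin_monotone_2pi) auto
  have pos: "cos y > 0" "sin x > 0" using assms by (auto intro: cos_gt_zero sin_gt_zero2)
  have "2 + 1 / cos x < 2 + 1 / cos y" "2 + 1 / sin y < 2 + 1 / sin x"
    using c s pos by (simp_all add: frac_less2)
  moreover have "2 + 1 / cos x > 0" "2 + 1 / sin y > 0" using c s pos by (simp_all add: add_pos_pos)
  ultimately have "(2 + 1 / cos x) / (2 + 1 / sin x) < (2 + 1 / cos y) / (2 + 1 / sin y)"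
    by (intro frac_less) auto
  then show ?thesis using assms by (simp add: H_of_eq)
qed

lemma H_of_surj:
  assumes "H > 0"
  obtains \<theta> where "0 < \<theta>" "\<theta> < pi / 2" "H_of \<theta> = H"
proof -
  \<comment> \<open>Multiplying the equation 2 + 1 / cos = H (2 + 1 / sin) by sin * cos gives a
    function continuous up to the endpoints of the interval, with end values - H and 1.\<close>
  define \<phi> where "\<phi> x = (2 * cos x + 1) * sin x - H * ((2 * sin x + 1) * cos x)" for x
  have "continuous_on {0..pi/2} \<phi>" unfolding \<phi>_def by (intro continuous_intros)
  moreover have ends: "\<phi> 0 < 0" "\<phi> (pi / 2) > 0" using assms by (auto simp: \<phi>_def)
  ultimately obtain x where x: "0 \<le> x" "x \<le> pi / 2" "\<phi> x = 0"
    using IVT'[of \<phi> 0 0 "pi / 2"] by auto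
  then have "x \<noteq> 0" "x \<noteq> pi / 2" using ends by (metis less_irrefl)+
  then have x': "0 < x" "x < pi / 2" using x by auto
  have pos: "cos x > 0" "sin x > 0" using x' by (auto intro: cos_gt_zero sin_gt_zero2)
  have "2 + 1 / sin x > 0" using pos by (simp add: add_pos_pos)
  moreover have "2 + 1 / cos x = H * (2 + 1 / sin x)"
    using x(3) pos by (simp add: \<phi>_def field_simps)
  ultimately have "H_of x = H" using x' by (simp add: H_of_eq)
  then show ?thesis using x' that by blast
qed

section \<open>Comparison of the residue with the energy\<close>

theorem theorem3p3:
  shows "(\<forall>\<theta>\<in>{0<..<pi/2}.
            is_eigenform (vicsek_cond (H_of \<theta>)) (1/3) \<and>
            (\<exists>C>0. \<forall>f :: real ^ 2 \<Rightarrow> real. finite_energy (f \<circ> to_rhombus \<theta>) \<longrightarrow>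
              (\<exists>r. has_residue_at_1 (zeta_comm \<theta> (\<lambda>x. complex_of_real (f x))) r \<and>
                   ennreal r = ennreal C *
                     self_similar_energy (vicsek_cond (H_of \<theta>)) (1/3) (f \<circ> to_rhombus \<theta>))))
       \<and> (\<forall>H>0. \<exists>!\<theta>. \<theta> \<in> {0<..<pi/2} \<and> H_of \<theta> = H)"
proof (intro conjI ballI allI impI)
  fix H :: real assume "H > 0"
  then obtain \<theta> where \<theta>: "0 < \<theta>" "\<theta> < pi / 2" "H_of \<theta> = H" using H_of_surj by blast
  show "\<exists>!\<theta>. \<theta> \<in> {0<..<pi/2} \<and> H_of \<theta> = H"
  proof (rule ex1I[of _ \<theta>])
    fix x assume "x \<in> {0<..<pi/2} \<and> H_of x = H"
    then show "x = \<theta>" using \<theta> H_of_strict_mono[of x \<theta>] H_of_strict_mono[of \<theta> x]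
      by (cases x \<theta> rule: linorder_cases) auto
  qed (use \<theta> in auto)
next
  fix \<theta> :: real assume "\<theta> \<in> {0<..<pi/2}"
  then have \<theta>: "0 < \<theta>" "\<theta> < pi / 2" by auto
  show "is_eigenform (vicsek_cond (H_of \<theta>)) (1/3)" by (rule is_eigenform_vicsek[OF H_of_pos[OF \<theta>]])
  have pos: "cos \<theta> > 0" "sin \<theta> > 0" using \<theta> by (auto intro: cos_gt_zero sin_gt_zero2)
  define H where "H = H_of \<theta>"
  define u v where "u = 1 / (2 * cos \<theta>)" and "v = 1 / (2 * sin \<theta>)"
  have uv: "u > 0" "v > 0" using pos by (auto simp: u_def v_def)
  have H: "H > 0" unfolding H_def by (rule H_of_pos[OF \<theta>])
  have "2 + 1 / cos \<theta> = 2 * (1 + u)" "2 + 1 / sin \<theta> = 2 * (1 + v)" by (simp_all add: u_def v_def)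
  then have "H = (2 * (1 + u)) / (2 * (1 + v))" unfolding H_def H_of_eq[OF \<theta>] by simp
  \<comment> \<open>(1 + u) / (1 + v) equals H, just as (1 + H) / (1 + 1 / H) does: the weights of
    \<open>P\<close> and \<open>Q\<close> in the residue and in the energy are proportional.\<close>
  then have Hv: "1 + u = H * (1 + v)" using uv by (simp add: field_simps)
  \<comment> \<open>The ratio of the weights of \<open>P\<close>, which is also that of
    \<open>Q\<close>, divided by ln 3 from the Abel limit.\<close>
  define C where "C = (1 + u) / (1 + H) / ln 3"
  have C: "C > 0" using uv H by (auto simp: C_def)
  show "\<exists>C>0. \<forall>f :: real ^ 2 \<Rightarrow> real. finite_energy (f \<circ> to_rhombus \<theta>) \<longrightarrow>
              (\<exists>r. has_residue_at_1 (zeta_comm \<theta> (\<lambda>x. complex_of_real (f x))) r \<and>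
                   ennreal r = ennreal C *
                     self_similar_energy (vicsek_cond (H_of \<theta>)) (1/3) (f \<circ> to_rhombus \<theta>))"
  proof (rule exI[of _ C], rule conjI[OF C], intro allI impI)
    fix f :: "real ^ 2 \<Rightarrow> real" assume "finite_energy (f \<circ> to_rhombus \<theta>)"
    then obtain P Q where lims: "(\<lambda>n. level_sum n (\<lambda>g. (mode1 g)\<^sup>2) (f \<circ> to_rhombus \<theta>)) \<longlonglongrightarrow> P"
      "(\<lambda>n. level_sum n (\<lambda>g. (mode2 g)\<^sup>2) (f \<circ> to_rhombus \<theta>)) \<longlonglongrightarrow> Q"
      "(\<lambda>n. level_sum n (\<lambda>g. (mode3 g)\<^sup>2) (f \<circ> to_rhombus \<theta>)) \<longlonglongrightarrow> 0"
      by (rule finite_energy_modes)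
    define r where "r = 8 * ((1 + u) * P + (1 + v) * Q) / ln 3"
    have "has_residue_at_1 (zeta_comm \<theta> (\<lambda>x. complex_of_real (f x))) r"
      unfolding r_def u_def v_def by (rule has_residue_zeta_comm[OF \<theta> lims])
    moreover have "ennreal r = ennreal C * self_similar_energy (vicsek_cond (H_of \<theta>)) (1/3) (f \<circ> to_rhombus \<theta>)"
    proof -
      define w where "w = 1 + H"
      have "w \<noteq> 0" "H \<noteq> 0" using H by (auto simp: w_def)
      then have "(1 + u) / w / l * (8 * (w * P + (w / H) * Q)) = 8 * ((1 + u) * P + (1 + u) / H * Q) / l" for l
        by (simp add: divide_simps) (simp add: algebra_simps)
      moreover have "w / H = 1 + 1 / H" using H by (simp add: w_def field_simps)
      moreover have "(1 + u) / H = 1 + v" using Hv H by simp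
      ultimately have "r = C * (8 * ((1 + H) * P + (1 + 1 / H) * Q))"
        unfolding r_def C_def w_def by metis
      then show ?thesis
        unfolding self_similar_energy_vicsek[OF lims] H_def[symmetric] using C by (simp add: ennreal_mult')
    qed
    ultimately show "\<exists>r. has_residue_at_1 (zeta_comm \<theta> (\<lambda>x. complex_of_real (f x))) r \<and>
        ennreal r = ennreal C * self_similar_energy (vicsek_cond (H_of \<theta>)) (1/3) (f \<circ> to_rhombus \<theta>)"
      by blast
  qed
qed

end
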